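(* For integers $N\geq 2$ and $1\leq p\leq\lfloor N/2\rfloor$, let $\mu^{(N,p)}$ be the maximum of $\frac{1}{N-1}\sum_{l=1}^{N-1}x_l$ over all $\bm{x}=(x_1,\dots,x_{N-1})\in\{0,1\}^{N-1}$ satisfying $x_k=x_{N-k}$ for all $k\in\{1,\dots,N-1\}$ and \[ \sum_{l=1}^{N-1}x_l\cos\left(\frac{2\pi pl}{N}\right)\left[-1+\cos\left(\frac{2\pi kl}{N}\right)\right]<0\quad\text{for all }k\in\{1,\dots,N-1\}. \] Let \[ \overline{\mu}=\sup\left\{\mu^{(N,p)}\;\middle|\; N\geq 2,\ 1\leq p\leq\lfloor N/2\rfloor\right\}. \] Then \[ \overline{\mu}=\frac{11}{19}-\frac{2}{19}\cdot\frac{\displaystyle\sum_{l=1}^{5}\left[-\cos\left(\frac{2\pi l}{19}\right)+\cos^{2}\left(\frac{2\pi l}{19}\right)\right]}{\displaystyle-\cos\left(\frac{12\pi}{19}\right)+\cos^{2}\left(\frac{12\pi}{19}\right)}=0.683875\cdots. \]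
   Context: Pairs $(N,p)$ for which no $\bm{x}$ satisfies the constraints do not contribute to the supremum. Interpretation: $\mu^{(N,p)}$ is the largest connectivity (common degree divided by $N-1$) of an undirected circulant network on $N$ nodes (adjacency entries $a_{ij}=x_{(j-i)\bmod N}$, $x_0=0$) for which the $p$-twisted state $\left(0,\frac{2\pi p}{N},\dots,\frac{2\pi p(N-1)}{N}\right)^{\mathsf T}$ of $\dot\theta_i=\sum_j a_{ij}\sin(\theta_j-\theta_i)$ is linearly stable. The notation $0.683875\cdots$ displays the leading decimal digits. *)

theory Defs
  imports "HOL-Analysis.Analysis"
begin

text \<open>
  A vector \<open>(x\<^sub>1, \<dots>, x\<^sub>N\<^sub>-\<^sub>1)\<close> with entries in \<open>{0, 1}\<close> is an element of
  \<open>{1..N-1} \<rightarrow>\<^sub>E {0, 1}\<close>: outside the index range it has the fixed value \<^const>\<open>undefined\<close>.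
\<close>

definition feasible :: "nat \<Rightarrow> nat \<Rightarrow> (nat \<Rightarrow> real) set" where
  "feasible N p = {x \<in> {1..N-1} \<rightarrow>\<^sub>E {0, 1}.
     (\<forall>k\<in>{1..N-1}. x k = x (N - k)) \<and>
     (\<forall>k\<in>{1..N-1}.
        (\<Sum>l=1..N-1. x l * cos (2 * pi * real p * real l / real N)
                      * (-1 + cos (2 * pi * real k * real l / real N))) < 0)}"

definition connectivity :: "nat \<Rightarrow> (nat \<Rightarrow> real) \<Rightarrow> real" where
  "connectivity N x = 1 / (real N - 1) * (\<Sum>l=1..N-1. x l)"

text \<open>The maximum is only meaningful when \<open>feasible N p\<close> is nonempty.\<close>

definition mu :: "nat \<Rightarrow> nat \<Rightarrow> real" where
  "mu N p = Max (connectivity N ` feasible N p)"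

text \<open>
  Pairs \<open>(N, p)\<close> without a feasible vector do not contribute to the supremum.
\<close>

definition mu_values :: "real set" where
  "mu_values = {mu N p | N p. 2 \<le> N \<and> 1 \<le> p \<and> p \<le> N div 2 \<and> feasible N p \<noteq> {}}"

definition mu_bar :: real where
  "mu_bar = Sup mu_values"

text \<open>
  The maxima are over finite sets, and the supremum is over a nonempty set bounded above,
  so neither \<^const>\<open>Max\<close> nor \<^const>\<open>Sup\<close> is applied outside its specified domain.
\<close>

lemma finite_feasible: "finite (feasible N p)"
proof (rule finite_subset)
  show "feasible N p \<subseteq> {1..N-1} \<rightarrow>\<^sub>E {0, 1}"
    by (auto simp: feasible_def)
qed (intro finite_PiE, auto)

lemma connectivity_le_1:
  assumes "2 \<le> N" "x \<in> feasible N p"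
  shows "connectivity N x \<le> 1"
proof -
  have "x l \<le> 1" if "l \<in> {1..N-1}" for l
    using PiE_mem[of x "{1..N-1}" "\<lambda>_. {0, 1}" l] assms(2) that
    by (auto simp: feasible_def)
  then have "(\<Sum>l=1..N-1. x l) \<le> (\<Sum>l=1..N-1. 1)"
    by (intro sum_mono) auto
  also have "\<dots> = real N - 1"
    using assms(1) by (simp add: of_nat_diff)
  finally show ?thesis
    using assms(1) by (simp add: connectivity_def field_simps)
qed

lemma bdd_above_mu_values: "bdd_above mu_values"
proof (rule bdd_aboveI[where M = 1])
  fix y assume "y \<in> mu_values"
  then obtain N p where "y = mu N p" "2 \<le> N" "feasible N p \<noteq> {}"
    by (auto simp: mu_values_def)
  then show "y \<le> 1"
    by (auto simp: mu_def finite_feasible intro: connectivity_le_1)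
qed

lemma mu_values_nonempty: "mu_values \<noteq> {}"
proof -
  define x :: "nat \<Rightarrow> real" where
    "x = (\<lambda>l\<in>{1..4}. if l = 1 \<or> l = 4 then 1 else 0)"
  have ivl: "{1..4::nat} = {1, 2, 3, 4}"
    by auto
  have c1: "cos (2 * pi / 5) > 0"
    by (rule cos_gt_zero_pi) (use pi_gt_zero in linarith)+
  have "cos (2 * pi * 4 / 5) = cos (2 * pi - 2 * pi / 5)"
    by (rule arg_cong[where f = cos]) simp
  then have c4: "cos (2 * pi * 4 / 5) = cos (2 * pi / 5)"
    by (simp only: cos_2pi_minus)
  have lt: "cos (2 * pi * real k / 5) < 1" if "k \<in> {1..4}" for k
  proof -
    have "cos (2 * pi * real k / 5) \<noteq> 1"
    proof
      assume "cos (2 * pi * real k / 5) = 1"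
      then obtain m :: int where "2 * pi * real k / 5 = of_int m * 2 * pi"
        by (auto simp: cos_one_2pi_int)
      then have "real_of_int (int k) = real_of_int (5 * m)"
        by (simp add: field_simps)
      then have "int k = 5 * m"
        by (simp only: of_int_eq_iff)
      with that show False
        by auto presburger
    qed
    then show ?thesis
      using cos_le_one[of "2 * pi * real k / 5"] by linarith
  qed
  have "x \<in> feasible 5 1"
  proof -
    have "(\<Sum>l=1..4. x l * cos (2 * pi * real 1 * real l / real 5)
             * (-1 + cos (2 * pi * real k * real l / real 5))) < 0"
      if k: "k \<in> {1..4}" for k
    proof -
      have "cos (2 * pi / 5) * (-1 + cos (2 * pi * real k / 5)) < 0"
        using c1 lt[OF k] by (intro mult_pos_neg) auto
      moreover have "cos (2 * pi / 5) * (-1 + cos (2 * pi * real k * 4 / 5)) \<le> 0"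
        using c1 by (intro mult_nonneg_nonpos) auto
      ultimately show ?thesis
        using c4 unfolding ivl by (simp add: x_def)
    qed
    then show ?thesis
      by (auto simp: feasible_def x_def)
  qed
  then have "mu 5 1 \<in> mu_values"
    unfolding mu_values_def by force
  then show ?thesis
    by blast
qed

end

theory Submission
  imports Defs
begin

text \<open>
  Write \<open>w t = (cos t)\<^sup>2 - cos t\<close> and let \<open>n = N / gcd N p\<close>. The constraint with \<open>k = p\<close> alone says that
  \<open>x\<close> has negative total weight \<open>w (2 * pi * p * l / N)\<close>. The angles run through the multiples of
  \<open>2 * pi / n\<close>, each taken equally often, so maximising the number of edges under this constraint
  is a knapsack problem whose fractional relaxation depends on \<open>n\<close> only. Its Lagrangian
  dual bounds the connectivity. For \<open>n \<le> 4\<close> the weights are nonnegative and nothing is feasible;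
  for \<open>n \<ge> 25\<close> the dual value is evaluated by the Dirichlet kernel with
  the multiplier of the cutoff angle \<open>2 * pi / 3\<close>; for \<open>5 \<le> n \<le> 24\<close> it is computed numerically, and
  \<open>n = 19\<close> gives the largest value. Conversely, on \<open>N = 19 * d\<close> nodes with \<open>p = d\<close>, the greedy
  solution for \<open>n = 19\<close> also satisfies the constraints for all other \<open>k\<close>, because the Dirichlet kernel
  of 13 residues modulo 19 is largest at \<open>1\<close> and \<open>-1\<close> outside \<open>0\<close>. Its connectivity tends to the bound as \<open>d\<close> grows.
\<close>

subsection \<open>Rational enclosures of cosines\<close>

text \<open>
  The Taylor polynomial of degree 14 of the cosine, in Horner form and with \<open>y\<close> standing for
  the square of the argument.
\<close>

definition cos_poly :: "real \<Rightarrow> real" where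
  "cos_poly y = 1 - y/2 * (1 - y/12 * (1 - y/30 * (1 - y/56 * (1 - y/90 * (1 - y/132 * (1 - y/182))))))"

text \<open>The coefficient of degree 15 vanishes, so the polynomial of degree 14 is the expansion
  to order 16 and the remainder carries \<open>x^16\<close>.\<close>

lemma cos_poly_error: "\<bar>cos x - cos_poly (x\<^sup>2)\<bar> \<le> x^16 / fact 16"
proof -
  obtain t where t: "cos x = (\<Sum>m<16. cos_coeff m * x ^ m)
      + cos (t + 1/2 * real 16 * pi) / fact 16 * x ^ 16"
    using Maclaurin_cos_expansion[of x 16] by blast
  have "(\<Sum>m<16. cos_coeff m * x ^ m) = 1 - x^2/2 + x^4/24 - x^6/720 + x^8/40320 - x^10/3628800
     + x^12/479001600 - x^14/87178291200"
    by (simp add: cos_coeff_def lessThan_nat_numeral lessThan_Suc fact_numeral)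
  also have "\<dots> = cos_poly (x\<^sup>2)"
    by (simp add: cos_poly_def algebra_simps power2_eq_square eval_nat_numeral)
  finally have "\<bar>cos x - cos_poly (x\<^sup>2)\<bar> = \<bar>cos (t + 1/2 * real 16 * pi)\<bar> * (x^16 / fact 16)"
    using t by (simp add: abs_mult)
  also have "\<dots> \<le> 1 * (x^16 / fact 16)"
    by (intro mult_right_mono abs_cos_le_one) auto
  finally show ?thesis by simp
qed

text \<open>\<open>cos_poly\<close> certifies a sign change of the cosine between 1.570796326 and
  1.570796327, which encloses \<open>pi / 2\<close>.\<close>

lemma pi_bounds: "3.141592652 < pi" "pi < 3.141592654"
proof -
  have "\<bar>cos 1.570796326 - cos_poly (1.570796326\<^sup>2)\<bar> \<le> 1.570796326^16 / fact 16"
    by (rule cos_poly_error)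
  moreover have "cos_poly (1.570796326\<^sup>2) > 1.570796326^16 / fact 16"
    by (simp add: cos_poly_def fact_numeral power_divide)
  ultimately have pos: "cos (1.570796326::real) > 0" by linarith
  have "\<bar>cos 1.570796327 - cos_poly (1.570796327\<^sup>2)\<bar> \<le> 1.570796327^16 / fact 16"
    by (rule cos_poly_error)
  moreover have "cos_poly (1.570796327\<^sup>2) < - (1.570796327^16 / fact 16)"
    by (simp add: cos_poly_def fact_numeral power_divide)
  ultimately have neg: "cos (1.570796327::real) < 0" by linarith
  show "3.141592652 < pi"
  proof (rule ccontr)
    assume "\<not> ?thesis"
    then have "cos 1.570796326 \<le> cos (pi/2)"
      using pi_gt3 by (intro cos_monotone_0_pi_le) auto
    with pos show False by simp
  qed
  show "pi < 3.141592654"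
  proof (rule ccontr)
    assume "\<not> ?thesis"
    then have "cos (pi/2) \<le> cos 1.570796327"
      using pi_gt3 by (intro cos_monotone_0_pi_le) auto
    with neg show False by simp
  qed
qed

text \<open>Both fractions are convergents of the continued fraction of \<open>pi\<close>. The short
  one suffices for the other small orders; order 19, which decides the digits of the result, uses
  the long one.\<close>

lemma pi_approximations: "\<bar>pi - 355/113\<bar> \<le> 3 / 10^7" "\<bar>pi - 103993/33102\<bar> \<le> 2 / 10^9"
  using pi_bounds unfolding abs_le_iff by simp_all

text \<open>The cosine is 1-Lipschitz, so replacing \<open>pi\<close> by \<open>P\<close> costs at
  most \<open>r * h\<close> on top of the Taylor error.\<close>

lemma cos_poly_pi_multiple:
  assumes "0 \<le> r" and P: "\<bar>pi - P\<bar> \<le> h"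
  shows "\<bar>cos (r * pi) - cos_poly ((r * P)\<^sup>2)\<bar> \<le> (r * P) ^ 16 / fact 16 + r * h"
proof -
  have lip: "\<bar>cos a - cos b\<bar> \<le> \<bar>a - b\<bar>" for a b :: real
  proof -
    have "\<bar>cos a - cos b\<bar> = 2 * \<bar>sin ((a + b) / 2)\<bar> * \<bar>sin ((b - a) / 2)\<bar>"
      by (simp add: cos_diff_cos abs_mult)
    also have "\<dots> \<le> 2 * 1 * \<bar>(b - a) / 2\<bar>"
      by (intro mult_mono abs_sin_le_one abs_sin_x_le_abs_x) auto
    finally show ?thesis by simp
  qed
  have "\<bar>cos (r * pi) - cos (r * P)\<bar> \<le> \<bar>r * pi - r * P\<bar>"
    by (rule lip)
  also have "\<dots> = r * \<bar>pi - P\<bar>"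
    using assms(1) by (simp only: right_diff_distrib[symmetric] abs_mult abs_of_nonneg)
  also have "\<dots> \<le> r * h"
    using P assms(1) by (rule mult_left_mono)
  finally show ?thesis
    using cos_poly_error[of "r * P"] by linarith
qed

definition weight :: "real \<Rightarrow> real" where
  "weight t = (cos t)\<^sup>2 - cos t"

text \<open>
  The list \<open>cs\<close> approximates the values \<open>cos (2 * pi * j / n)\<close> for \<open>j = 0, 1, \<dots>\<close>, and \<open>P\<close>
  stands for a rational approximation of \<open>pi\<close>, so that the predicate is a statement about
  rational numbers. A short fraction \<open>P\<close> keeps its verification cheap.
\<close>

definition cos_table :: "real \<Rightarrow> real \<Rightarrow> nat \<Rightarrow> real list \<Rightarrow> bool" where
  "cos_table P d n cs \<longleftrightarrow> list_all (\<lambda>(j, c). \<bar>cos_poly ((2 * real j / real n * P)\<^sup>2) - c\<bar> \<le> d)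
     (List.enumerate 0 cs)"

lemma cos_table_weight_error:
  assumes P: "0 \<le> P" "\<bar>pi - P\<bar> \<le> h"
    and tab: "cos_table P d n cs" "j < length cs" "2 * real j / real n \<le> b"
    and e: "(b * P) ^ 16 / fact 16 + b * h + d \<le> e" "e \<le> 1"
  shows "\<bar>weight (2 * pi * real j / real n) - ((cs ! j)\<^sup>2 - cs ! j)\<bar> \<le> 4 * e"
proof -
  define r where "r = 2 * real j / real n"
  have r: "0 \<le> r" "r \<le> b"
    using tab(3) by (auto simp: r_def)
  have h: "0 \<le> h"
    using P(2) by linarith
  have arg: "2 * pi * real j / real n = r * pi"
    by (simp add: r_def)
  have "\<bar>cos_poly ((r * P)\<^sup>2) - cs ! j\<bar> \<le> d"
    using tab(1,2) by (auto simp: cos_table_def list_all_length nth_enumerate_eq r_def)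
  moreover have "\<bar>cos (r * pi) - cos_poly ((r * P)\<^sup>2)\<bar>
      \<le> (r * P) ^ 16 / fact 16 + r * h"
    using r(1) P(2) by (rule cos_poly_pi_multiple)
  moreover have "(r * P) ^ 16 / fact 16 + r * h
      \<le> (b * P) ^ 16 / fact 16 + b * h"
    using r P h by (intro add_mono divide_right_mono power_mono mult_right_mono mult_nonneg_nonneg) auto
  ultimately have err: "\<bar>cos (r * pi) - cs ! j\<bar> \<le> e"
    using e(1) by linarith
  have "\<bar>cos (r * pi)\<bar> \<le> 1"
    by simp
  \<comment> \<open>The difference of \<open>a\<^sup>2 - a\<close> and \<open>b\<^sup>2 - b\<close>
    is \<open>(a - b) * (a + b - 1)\<close>. This bounds the second factor and is the source of the
    4 in the conclusion.\<close>
  then have "\<bar>cos (r * pi) + cs ! j - 1\<bar> \<le> 4"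
    using err e(2) by linarith
  then have "\<bar>cos (r * pi) - cs ! j\<bar> * \<bar>cos (r * pi) + cs ! j - 1\<bar> \<le> e * 4"
    using err by (intro mult_mono) auto
  moreover have "weight (r * pi) - ((cs ! j)\<^sup>2 - cs ! j) = (cos (r * pi) - cs ! j) * (cos (r * pi) + cs ! j - 1)"
    by (simp add: weight_def algebra_simps power2_eq_square)
  ultimately show ?thesis
    by (simp add: abs_mult arg)
qed

text \<open>Every weight carries an error of at most \<open>4 * e\<close>, so the numerical surplus
  in the last hypothesis settles the sign. Free coefficients \<open>a\<close> and \<open>s\<close>
  give lower and upper bounds alike.\<close>

lemma cos_table_weight_sum:
  assumes P: "0 \<le> P" "\<bar>pi - P\<bar> \<le> h"
    and tab: "cos_table P d n (cs @ [c])"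
    and "0 < n" and m: "m = length cs" "2 * real m \<le> b * real n"
    and e: "(b * P) ^ 16 / fact 16 + b * h + d \<le> e" "e \<le> 1"
    and num: "4 * e * (\<bar>a\<bar> + \<bar>s\<bar> * real m) \<le> a * (c\<^sup>2 - c) + s * (\<Sum>c\<leftarrow>cs. c\<^sup>2 - c)"
  shows "0 \<le> a * weight (2 * pi * real m / real n) + s * (\<Sum>j<m. weight (2 * pi * real j / real n))"
proof -
  define w where "w = (\<lambda>j. weight (2 * pi * real j / real n))"
  have err: "\<bar>w j - (((cs @ [c]) ! j)\<^sup>2 - (cs @ [c]) ! j)\<bar> \<le> 4 * e" if "j \<le> m" for j
    unfolding w_def
  proof (rule cos_table_weight_error[OF P tab _ _ e])
    show "j < length (cs @ [c])"
      using that m by simp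
    have "2 * real j \<le> b * real n"
      using that m(2) by linarith
    then show "2 * real j / real n \<le> b"
      using \<open>0 < n\<close> by (simp add: field_simps)
  qed
  have "\<bar>w m - (c\<^sup>2 - c)\<bar> \<le> 4 * e"
    using err[of m] m by simp
  then have "\<bar>a * (w m - (c\<^sup>2 - c))\<bar> \<le> \<bar>a\<bar> * (4 * e)"
    unfolding abs_mult by (intro mult_left_mono) auto
  moreover have "\<bar>w j - ((cs ! j)\<^sup>2 - cs ! j)\<bar> \<le> 4 * e" if "j < m" for j
    using err[of j] that m(1) by (simp add: nth_append)
  then have "\<bar>\<Sum>j<m. w j - ((cs ! j)\<^sup>2 - cs ! j)\<bar> \<le> (\<Sum>j<m. 4 * e)"
    by (intro order.trans[OF sum_abs] sum_mono) auto
  then have "\<bar>(\<Sum>j<m. w j) - (\<Sum>j<m. (cs ! j)\<^sup>2 - cs ! j)\<bar> \<le> real m * (4 * e)"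
    by (simp add: sum_subtractf)
  moreover have "(\<Sum>j<m. (cs ! j)\<^sup>2 - cs ! j) = (\<Sum>c\<leftarrow>cs. c\<^sup>2 - c)"
    by (simp add: m(1) sum_list_sum_nth atLeast0LessThan)
  moreover have "\<bar>s * ((\<Sum>j<m. w j) - (\<Sum>j<m. (cs ! j)\<^sup>2 - cs ! j))\<bar> \<le> \<bar>s\<bar> * (real m * (4 * e))"
    using calculation(2) unfolding abs_mult by (intro mult_left_mono) auto
  ultimately have "\<bar>a * w m - a * (c\<^sup>2 - c)\<bar> \<le> \<bar>a\<bar> * (4 * e)"
    "\<bar>s * (\<Sum>j<m. w j) - s * (\<Sum>c\<leftarrow>cs. c\<^sup>2 - c)\<bar> \<le> \<bar>s\<bar> * (real m * (4 * e))"
    by (simp_all only: right_diff_distrib)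
  moreover have "4 * e * (\<bar>a\<bar> + \<bar>s\<bar> * real m) = \<bar>a\<bar> * (4 * e) + \<bar>s\<bar> * (real m * (4 * e))"
    by (simp add: algebra_simps)
  ultimately show ?thesis
    using num unfolding abs_le_iff w_def by linarith
qed

text \<open>This is \<open>dual_value n (1 / weight t) \<le> real n * 0.683875\<close>, cleared of
  denominators, where \<open>t\<close> is the grid angle of index \<open>m\<close>. Rounding
  \<open>n / 3\<close> to \<open>m\<close> puts \<open>t\<close> near
  \<open>2 * pi / 3\<close>.\<close>

lemma small_order_weight_sum:
  fixes n m :: nat
  assumes "5 \<le> n" "n \<le> 24" "n \<noteq> 19" and m: "m = (n + 1) div 3"
  shows "0 \<le> (real n * 0.683875 - (2 * real m - 1)) * weight (2 * pi * real m / real n)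
           + 2 * (\<Sum>j<m. weight (2 * pi * real j / real n))"
proof -
  have "n \<in> {5,6,7,8,9,10,11,12,13,14,15,16,17,18,20,21,22,23,24}"
    using assms(1-3) by simp presburger
  \<comment> \<open>Error budget: \<open>2 * m / n\<close> is at most \<open>4/5\<close>, attained
    at \<open>n = 5\<close>. Taylor, \<open>pi\<close> and table errors together stay below
    \<open>1.5/10^6\<close>, and four times this is the margin \<open>6/10^6\<close>.\<close>
  moreover have table: ?thesis if "cos_table (355/113) (1/10^6) n (cs @ [c])" "length cs = (n + 1) div 3" "0 < n"
      "5 * ((n + 1) div 3) \<le> 2 * n"
      "(real n * 0.683875 - (2 * real m - 1)) * (c\<^sup>2 - c) + 2 * (\<Sum>c\<leftarrow>cs. c\<^sup>2 - c)
        \<ge> 6/10^6 * (\<bar>real n * 0.683875 - (2 * real m - 1)\<bar> + 2 * real m)" for cs c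
  proof (rule cos_table_weight_sum[OF _ pi_approximations(1) that(1,3)])
    show "m = length cs"
      using m that(2) by simp
    show "2 * real m \<le> 4/5 * real n"
      using m that(4) by simp
    show "(4/5 * (355/113)) ^ 16 / fact 16 + 4/5 * (3 / 10^7) + 1/10^6 \<le> (6/4/10^6 :: real)"
      by (simp add: fact_numeral power_divide)
  qed (use that(5) in simp_all)
  ultimately show ?thesis
  proof (elim insertE emptyE)
    assume n: "n = 5"
    show ?thesis
      by (rule table[of "[1, 0.309017]" "- 0.809017"])
        (simp_all add: n m cos_table_def cos_poly_def power_divide)
  next
    assume n: "n = 6"
    show ?thesis
      by (rule table[of "[1, 0.5]" "- 0.5"])
        (simp_all add: n m cos_table_def cos_poly_def power_divide)
  next
    assume n: "n = 7"
    show ?thesis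
      by (rule table[of "[1, 0.6234898]" "- 0.2225209"])
        (simp_all add: n m cos_table_def cos_poly_def power_divide)
  next
    assume n: "n = 8"
    show ?thesis
      by (rule table[of "[1, 0.7071068, 0]" "- 0.7071068"])
        (simp_all add: n m cos_table_def cos_poly_def power_divide)
  next
    assume n: "n = 9"
    show ?thesis
      by (rule table[of "[1, 0.7660444, 0.1736482]" "- 0.5"])
        (simp_all add: n m cos_table_def cos_poly_def power_divide)
  next
    assume n: "n = 10"
    show ?thesis
      by (rule table[of "[1, 0.809017, 0.309017]" "- 0.309017"])
        (simp_all add: n m cos_table_def cos_poly_def power_divide)
  next
    assume n: "n = 11"
    show ?thesis
      by (rule table[of "[1, 0.8412535, 0.415415, - 0.1423148]" "- 0.6548607"])
        (simp_all add: n m cos_table_def cos_poly_def power_divide)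
  next
    assume n: "n = 12"
    show ?thesis
      by (rule table[of "[1, 0.8660254, 0.5, 0]" "- 0.5"])
        (simp_all add: n m cos_table_def cos_poly_def power_divide)
  next
    assume n: "n = 13"
    show ?thesis
      by (rule table[of "[1, 0.885456, 0.5680647, 0.1205367]" "- 0.3546049"])
        (simp_all add: n m cos_table_def cos_poly_def power_divide)
  next
    assume n: "n = 14"
    show ?thesis
      by (rule table[of "[1, 0.9009689, 0.6234898, 0.2225209, - 0.2225209]" "- 0.6234898"])
        (simp_all add: n m cos_table_def cos_poly_def power_divide)
  next
    assume n: "n = 15"
    show ?thesis
      by (rule table[of "[1, 0.9135455, 0.6691306, 0.309017, - 0.1045285]" "- 0.5"])
        (simp_all add: n m cos_table_def cos_poly_def power_divide)
  next
    assume n: "n = 16"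
    show ?thesis
      by (rule table[of "[1, 0.9238795, 0.7071068, 0.3826834, 0]" "- 0.3826834"])
        (simp_all add: n m cos_table_def cos_poly_def power_divide)
  next
    assume n: "n = 17"
    show ?thesis
      by (rule table[of "[1, 0.9324722, 0.7390089, 0.4457384, 0.0922684, - 0.273663]" "- 0.6026346"])
        (simp_all add: n m cos_table_def cos_poly_def power_divide)
  next
    assume n: "n = 18"
    show ?thesis
      by (rule table[of "[1, 0.9396926, 0.7660444, 0.5, 0.1736482, - 0.1736482]" "- 0.5"])
        (simp_all add: n m cos_table_def cos_poly_def power_divide)
  next
    assume n: "n = 20"
    show ?thesis
      by (rule table[of "[1, 0.9510565, 0.809017, 0.5877853, 0.309017, 0, - 0.309017]" "- 0.5877853"])
        (simp_all add: n m cos_table_def cos_poly_def power_divide)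
  next
    assume n: "n = 21"
    show ?thesis
      by (rule table[of "[1, 0.9555728, 0.8262388, 0.6234898, 0.365341, 0.0747301, - 0.2225209]" "- 0.5"])
        (simp_all add: n m cos_table_def cos_poly_def power_divide)
  next
    assume n: "n = 22"
    show ?thesis
      by (rule table[of "[1, 0.959493, 0.8412535, 0.6548607, 0.415415, 0.1423148, - 0.1423148]" "- 0.415415"])
        (simp_all add: n m cos_table_def cos_poly_def power_divide)
  next
    assume n: "n = 23"
    show ?thesis
      by (rule table[of "[1, 0.9629173, 0.8544194, 0.6825531, 0.460065, 0.203456, - 0.0682424, - 0.3348796]" "- 0.5766803"])
        (simp_all add: n m cos_table_def cos_poly_def power_divide)
  next
    assume n: "n = 24"
    show ?thesis
      by (rule table[of "[1, 0.9659258, 0.8660254, 0.7071068, 0.5, 0.258819, 0, - 0.258819]" "- 0.5"])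
        (simp_all add: n m cos_table_def cos_poly_def power_divide)
  qed
qed

text \<open>The constants are the decimals of the result:
  \<open>1.993625 = 19 * 0.683875 - 11\<close>, and 1.993643 lies just below
  \<open>19 * 0.683876 - 11\<close>.\<close>

lemma weight_19_bounds:
  shows "0 < weight (12 * pi / 19)"
    and "1.993625 * weight (12 * pi / 19) \<le> - 2 * (\<Sum>j<6. weight (2 * pi * real j / 19))"
    and "- 2 * (\<Sum>j<6. weight (2 * pi * real j / 19)) \<le> 1.993643 * weight (12 * pi / 19)"
proof -
  have "cos (12 * pi / 19) < cos (pi / 2)"
    by (rule cos_monotone_0_pi) auto
  then have "0 < (- cos (12 * pi / 19)) * (1 - cos (12 * pi / 19))"
    by (intro mult_pos_pos) auto
  then show "0 < weight (12 * pi / 19)"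
    by (simp add: weight_def power2_eq_square algebra_simps)
  let ?cs = "[1, 0.945817242, 0.789140509, 0.546948158, 0.245485487, - 0.082579345]" and ?c = "- 0.401695425"
  have tab: "cos_table (103993/33102) (1/10^8) 19 (?cs @ [?c])"
    by (simp add: cos_table_def cos_poly_def power_divide)
  have *: "0 \<le> a * weight (12 * pi / 19) + s * (\<Sum>j<6. weight (2 * pi * real j / 19))"
    if "8/10^8 * (\<bar>a\<bar> + \<bar>s\<bar> * 6) \<le> a * (?c\<^sup>2 - ?c) + s * (\<Sum>c\<leftarrow>?cs. c\<^sup>2 - c)" for a s
  proof -
    have "0 \<le> a * weight (2 * pi * real 6 / real 19) + s * (\<Sum>j<6. weight (2 * pi * real j / real 19))"
      using that by (intro cos_table_weight_sum[OF _ pi_approximations(2) tab, where b = "12/19" and e = "2/10^8"])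
        (auto simp: fact_numeral power_divide)
    then show ?thesis by (simp add: mult.commute)
  qed
  show "- 2 * (\<Sum>j<6. weight (2 * pi * real j / 19)) \<le> 1.993643 * weight (12 * pi / 19)"
    using *[of "1.993643" 2] by (simp add: power2_eq_square)
  show "1.993625 * weight (12 * pi / 19) \<le> - 2 * (\<Sum>j<6. weight (2 * pi * real j / 19))"
    using *[of "- 1.993625" "-2"] by (simp add: power2_eq_square)
qed

subsection \<open>Linear programming duality\<close>

text \<open>The weight is not monotone on \<open>[0, pi]\<close>: it falls up to
  \<open>pi / 3\<close> and rises afterwards. Comparison with an angle of nonpositive cosine still
  works, by the sign of \<open>(cos s - cos t) * (cos s + cos t - 1)\<close>.\<close>

lemma weight_le_cutoff:
  assumes "0 \<le> s" "s \<le> t" "t \<le> pi" "cos t \<le> 0"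
  shows "weight s \<le> weight t"
proof -
  have "cos t \<le> cos s"
    using assms by (intro cos_monotone_0_pi_le) auto
  moreover have "cos s + cos t - 1 \<le> 0"
    using assms(4) cos_le_one[of s] by linarith
  ultimately have "(cos s - cos t) * (cos s + cos t - 1) \<le> 0"
    by (intro mult_nonneg_nonpos) auto
  then show ?thesis
    by (simp add: weight_def algebra_simps power2_eq_square)
qed

lemma weight_ge_cutoff:
  assumes "0 \<le> s" "s \<le> t" "t \<le> pi" "cos s \<le> 0"
  shows "weight s \<le> weight t"
proof -
  have "cos t \<le> cos s"
    using assms by (intro cos_monotone_0_pi_le) auto
  then have "0 \<le> (cos s - cos t) * (1 - cos s - cos t)"
    using assms(4) by (intro mult_nonneg_nonneg) auto
  then show ?thesis
    by (simp add: weight_def algebra_simps power2_eq_square)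
qed

lemma weight_pos: "cos t < 0 \<Longrightarrow> 0 < weight t"
  by (simp add: weight_def add_nonneg_pos diff_less_eq pos_add_strict less_le_trans[of _ 0])

lemma weight_reflect:
  assumes "j \<le> n" "0 < n"
  shows "weight (2 * pi * real (n - j) / real n) = weight (2 * pi * real j / real n)"
proof -
  have "2 * pi * real (n - j) / real n = 2 * pi - 2 * pi * real j / real n"
    using assms by (simp add: of_nat_diff field_simps)
  then show ?thesis
    by (simp add: weight_def cos_2pi_minus)
qed

text \<open>
  The Lagrangian dual of the fractional knapsack problem on the \<open>n\<close>-th roots of unity, with
  multiplier \<open>r\<close> for the constraint on the total weight.
\<close>

definition dual_value :: "nat \<Rightarrow> real \<Rightarrow> real" where
  "dual_value n r = (\<Sum>j<n. max 0 (1 - r * weight (2 * pi * real j / real n)))"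

text \<open>With this multiplier the terms of the dual vanish from the angle \<open>t\<close> on,
  symmetrically about 0. The indices below \<open>m\<close> and their mirror images survive; 0 is
  its own mirror image, hence \<open>2 * real m - 1\<close>.\<close>

lemma dual_value_cutoff:
  assumes "0 < m" "2 * pi * (real m - 1) / real n \<le> t" "t \<le> 2 * pi * real m / real n"
    and "0 < n" "pi / 2 < t" "t < pi"
  shows "dual_value n (1 / weight t) = 2 * real m - 1 - 2 * (\<Sum>j<m. weight (2 * pi * real j / real n)) / weight t"
proof -
  define w where "w = (\<lambda>j. weight (2 * pi * real j / real n))"
  define h where "h = (\<lambda>j. max 0 (1 - 1 / weight t * w j))"
  have cost: "cos t < 0"
    using assms(5,6) cos_monotone_0_pi[of "pi/2" t] by simp
  have t0: "0 \<le> t"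
    using assms(5) pi_gt_zero by linarith
  have pos: "0 < weight t"
    using weight_pos[OF cost] .
  have "2 * pi * (real m - 1) \<le> t * real n"
    using assms(2,4) by (simp add: field_simps)
  also have "\<dots> < pi * real n"
    using assms(4,6) by simp
  finally have "pi * (2 * (real m - 1)) < pi * real n"
    by (simp add: algebra_simps)
  then have "2 * (real m - 1) < real n"
    by simp
  then have "real (2 * m) < real (n + 2)"
    by simp
  then have mn: "2 * m < n + 2"
    by (simp only: of_nat_less_iff)
  have inside: "h j = 1 - w j / weight t" if "j < m" for j
  proof -
    have "real j \<le> real m - 1"
      using that by linarith
    then have "2 * pi * real j / real n \<le> 2 * pi * (real m - 1) / real n"
      by (intro divide_right_mono mult_left_mono) auto
    also have "\<dots> \<le> t" by fact
    finally have "w j \<le> weight t"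
      unfolding w_def using assms(6) cost by (intro weight_le_cutoff) auto
    then show ?thesis
      using pos by (simp add: h_def)
  qed
  have outside: "h j = 0" if "m \<le> j" "2 * j \<le> n" for j
  proof -
    have "t \<le> 2 * pi * real m / real n" by fact
    also have "\<dots> \<le> 2 * pi * real j / real n"
      using that by (intro divide_right_mono mult_left_mono) auto
    finally have "weight t \<le> w j"
      unfolding w_def using assms(4,5) cost that t0
      by (intro weight_ge_cutoff) (auto simp: field_simps)
    then show ?thesis
      using pos by (simp add: h_def)
  qed
  have reflect: "h (n - j) = h j" if "j \<le> n" for j
    using weight_reflect[OF that assms(4)] by (simp add: h_def w_def)
  have middle: "h j = 0" if "m \<le> j" "j < n - m + 1" for j
  proof (cases "2 * j \<le> n")
    case True
    then show ?thesis using outside that by blast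
  next
    case False
    then have "h (n - j) = 0"
      using that by (intro outside) auto
    then show ?thesis
      using reflect[of j] that assms(1) by simp
  qed
  \<comment> \<open>The middle block, possibly empty, ends at \<open>n - m\<close>, the mirror image
    of \<open>m\<close>; the last block mirrors \<open>1, ..., m - 1\<close>.\<close>
  have split: "{..<n} = {..<m} \<union> ({m..<n - m + 1} \<union> {n - m + 1..<n})"
    using mn assms(1) by auto
  have "(\<Sum>j<n. h j) = (\<Sum>j<m. h j) + ((\<Sum>j=m..<n - m + 1. h j) + (\<Sum>j=n - m + 1..<n. h j))"
    unfolding split using mn by (subst sum.union_disjoint; (subst sum.union_disjoint)?) auto
  also have "(\<Sum>j=m..<n - m + 1. h j) = 0"
    using middle by (intro sum.neutral) auto
  also have "(\<Sum>j=n - m + 1..<n. h j) = (\<Sum>j=1..<m. h j)"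
    using mn by (intro sum.reindex_bij_witness[of _ "\<lambda>j. n - j" "\<lambda>j. n - j"]) (auto simp: reflect)
  also have "(\<Sum>j=1..<m. h j) = (\<Sum>j<m. h j) - 1"
    using assms(1) inside[of 0]
    by (simp add: lessThan_atLeast0 sum.atLeast_Suc_lessThan w_def weight_def)
  also have "(\<Sum>j<m. h j) = real m - (\<Sum>j<m. w j) / weight t"
    by (simp add: inside sum_subtractf sum_divide_distrib)
  finally show ?thesis
    by (simp add: dual_value_def h_def w_def algebra_simps)
qed

section \<open>Dual values for small and large orders\<close>

lemma dirichlet_kernel:
  "0 < m \<Longrightarrow> sin t * (2 * (\<Sum>j<m. cos (2 * real j * t)) - 1) = sin ((2 * real m - 1) * t)"
proof (induction m rule: nat_induct_non_zero)
  case 1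
  then show ?case by simp
next
  case (Suc m)
  \<comment> \<open>The sum telescopes, as \<open>2 * sin t * cos (2 * m * t)\<close> is
    \<open>sin ((2 * m + 1) * t) - sin ((2 * m - 1) * t)\<close>.\<close>
  have "sin t * (2 * (\<Sum>j<Suc m. cos (2 * real j * t)) - 1)
      = sin ((2 * real m - 1) * t) + 2 * sin t * cos (2 * real m * t)"
    using Suc by (simp add: algebra_simps)
  also have "\<dots> = sin ((2 * real m + 1) * t)"
    by (simp add: algebra_simps sin_add sin_diff)
  finally show ?case
    by (simp add: algebra_simps)
qed

lemma sin_ge_cubic: "0 \<le> x \<Longrightarrow> x - x^3 / 6 \<le> sin x" for x :: real
  using Maclaurin_sin_bound[of x 3]
  by (simp add: lessThan_nat_numeral lessThan_Suc sin_coeff_def fact_numeral abs_if split: if_splits)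

lemma cos_ge_quadratic: "1 - x\<^sup>2 / 2 \<le> cos x" for x :: real
proof -
  have "(sin (x / 2))\<^sup>2 \<le> (x / 2)\<^sup>2"
    using abs_sin_x_le_abs_x[of "x/2"] by (simp only: abs_le_square_iff)
  then show ?thesis
    using cos_double_sin[of "x/2"] by (simp add: power_divide)
qed

lemma dual_value_small:
  assumes "5 \<le> n" "n \<le> 24" "n \<noteq> 19"
  shows "\<exists>r\<ge>0. dual_value n r \<le> real n * 0.683875"
proof -
  define m where "m = (n + 1) div 3"
  define t where "t = 2 * pi * real m / real n"
  have m: "0 < m" "n < 4 * m" "2 * m < n"
    using assms(1) by (auto simp: m_def)
  have t: "pi / 2 < t" "t < pi"
    using m by (simp_all add: t_def field_simps)
  have "cos t < 0"
    using t cos_monotone_0_pi[of "pi/2" t] by simp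
  then have pos: "0 < weight t"
    by (rule weight_pos)
  have "dual_value n (1 / weight t) = 2 * real m - 1 - 2 * (\<Sum>j<m. weight (2 * pi * real j / real n)) / weight t"
    using m t by (intro dual_value_cutoff) (auto simp: t_def divide_right_mono)
  also have "\<dots> \<le> real n * 0.683875"
    using small_order_weight_sum[OF assms m_def, folded t_def] pos by (simp add: field_simps)
  finally show ?thesis
    using pos by (intro exI[of _ "1 / weight t"]) auto
qed

lemma dual_value_19:
  "dual_value 19 (1 / weight (12 * pi / 19))
    = 11 - 2 * (\<Sum>j<6. weight (2 * pi * real j / 19)) / weight (12 * pi / 19)"
  using dual_value_cutoff[of 6 19 "12 * pi / 19"] by simp

text \<open>Halving the square of the cosine via the double angle splits the weight sum into two
  Dirichlet kernels, at \<open>d\<close> and \<open>2 * d\<close>. The index \<open>m\<close> is the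
  first one beyond \<open>n / 3\<close>, matching the cutoff angle
  \<open>2 * pi / 3\<close>.\<close>

lemma dual_value_large_closed_form:
  assumes "25 \<le> n" and d: "d = pi / real n" and m: "m = n div 3 + 1"
  shows "dual_value n (4/3) = (2 * real m - 1) / 3
           + 4/3 * (sin ((2 * real m - 1) * d) / sin d - sin ((2 * real m - 1) * (2 * d)) / (2 * sin (2 * d)))"
proof -
  have "0 < d" "2 * d < pi"
    using assms(1) by (simp_all add: d field_simps)
  then have sin_pos: "0 < sin d" "0 < sin (2 * d)"
    by (auto intro!: sin_gt_zero)
  have kernel: "2 * (\<Sum>j<m. cos (2 * real j * t)) = 1 + sin ((2 * real m - 1) * t) / sin t" if "0 < sin t" for t
    using dirichlet_kernel[of m t] that m by (simp add: field_simps)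
  have w: "weight (2 * pi * real j / real n) = 1/2 + cos (2 * real j * (2 * d)) / 2 - cos (2 * real j * d)" for j
  proof -
    have "2 * pi * real j / real n = 2 * real j * d"
      by (simp add: d)
    moreover have "cos (2 * real j * (2 * d)) = 2 * (cos (2 * real j * d))\<^sup>2 - 1"
      using cos_double_cos[of "2 * real j * d"] by (simp add: algebra_simps)
    ultimately show ?thesis
      by (simp add: weight_def diff_divide_distrib)
  qed
  have "2 * (\<Sum>j<m. weight (2 * pi * real j / real n))
      = real m + (2 * (\<Sum>j<m. cos (2 * real j * (2 * d)))) / 2 - 2 * (\<Sum>j<m. cos (2 * real j * d))"
    by (simp add: w sum.distrib sum_subtractf sum_divide_distrib[symmetric])
  also have "\<dots> = real m - 1/2 + sin ((2 * real m - 1) * (2 * d)) / (2 * sin (2 * d))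
      - sin ((2 * real m - 1) * d) / sin d"
    unfolding kernel[OF sin_pos(1)] kernel[OF sin_pos(2)] by (simp add: field_simps)
  finally have sum: "2 * (\<Sum>j<m. weight (2 * pi * real j / real n)) = \<dots>" .
  have weight_120: "weight (2 * pi / 3) = 3/4"
    by (simp add: weight_def cos_120 power2_eq_square)
  have "dual_value n (1 / weight (2 * pi / 3))
      = 2 * real m - 1 - 2 * (\<Sum>j<m. weight (2 * pi * real j / real n)) / weight (2 * pi / 3)"
  proof (rule dual_value_cutoff)
    have "3 * (n div 3) \<le> n" "n \<le> 3 * (n div 3 + 1)"
      by presburger+
    then have "3 * (real m - 1) \<le> real n" "real n \<le> 3 * real m"
      by (simp_all add: m flip: of_nat_le_iff[where 'a = real])
    then have "2 * pi * (3 * (real m - 1)) \<le> 2 * pi * real n" "2 * pi * real n \<le> 2 * pi * (3 * real m)"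
      by (simp_all only: mult_le_cancel_left_pos pi_gt_zero mult_pos_pos zero_less_numeral)
    then show "2 * pi * (real m - 1) / real n \<le> 2 * pi / 3" "2 * pi / 3 \<le> 2 * pi * real m / real n"
      using assms(1) by (simp_all add: field_simps)
  qed (use assms(1) m in auto)
  then show ?thesis
    unfolding weight_120 sum by (simp add: algebra_simps add_divide_distrib diff_divide_distrib)
qed

text \<open>
  The multiplier \<open>4/3 = 1 / weight (2 * pi / 3)\<close> is close to the optimal one for large \<open>n\<close>, and
  its cutoff angle has explicit sine and cosine. The leading terms of the bound are
  stationary at \<open>u = 2 * pi / 3\<close>, so the deviation \<open>w\<close> only contributes to higher order.
\<close>

lemma dual_value_large:
  assumes "25 \<le> n"
  shows "dual_value n (4/3) \<le> real n * 0.683875"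
proof -
  define d where "d = pi / real n"
  define m where "m = n div 3 + 1"
  define u where "u = (2 * real m - 1) * d"
  define w where "w = u - 2 * pi / 3"
  define A B where "A = d / sin d" and "B = d / sin (2 * d)"
  \<comment> \<open>The decimals below come from \<open>d \<le> pi / 25\<close>: 0.997367, 0.98947
    and 0.0078967 estimate \<open>1 - d\<^sup>2 / 6\<close>, \<open>1 - 2 * d\<^sup>2 / 3\<close>
    and \<open>d\<^sup>2 / 2\<close> from the safe side.\<close>
  have "pi / real n \<le> pi / 25"
    using assms by (intro divide_left_mono) auto
  then have d: "0 < d" "d \<le> 0.12567"
    using assms pi_bounds by (auto simp: d_def)
  have dsq: "d\<^sup>2 \<le> 0.0157934"
  proof -
    have "d\<^sup>2 \<le> 0.12567\<^sup>2"
      using d by (intro power_mono) auto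
    then show ?thesis by (simp add: power2_eq_square)
  qed
  have "2 * d < pi"
    using d pi_gt3 by simp
  then have sin_pos: "0 < sin d" "0 < sin (2 * d)"
    using d by (auto intro!: sin_gt_zero)
  have "d * 0.997367 \<le> d * (1 - d\<^sup>2 / 6)"
    using d dsq by (intro mult_left_mono) auto
  also have "\<dots> = d - d^3 / 6"
    by (simp add: algebra_simps power3_eq_cube power2_eq_square)
  also have "\<dots> \<le> sin d"
    using d by (intro sin_ge_cubic) auto
  finally have A: "A \<le> 1 / 0.997367"
    using sin_pos by (simp add: A_def field_simps)
  have "2 * d * 0.98947 \<le> 2 * d * (1 - (2 * d)\<^sup>2 / 6)"
    using d dsq by (intro mult_left_mono) (auto simp: power_mult_distrib)
  also have "\<dots> = 2 * d - (2 * d)^3 / 6"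
    by (simp add: algebra_simps power3_eq_cube power2_eq_square)
  also have "\<dots> \<le> sin (2 * d)"
    using d by (intro sin_ge_cubic) auto
  finally have B: "B \<le> 1 / (2 * 0.98947)"
    using sin_pos by (simp add: B_def field_simps)
  have "sin d \<le> d" "sin (2 * d) \<le> 2 * d"
    using d by (auto intro!: sin_x_le_x)
  then have A1: "1 \<le> A" and B1: "1/2 \<le> B"
    using sin_pos by (auto simp: A_def B_def field_simps)
  have w: "\<bar>w\<bar> \<le> d"
  proof -
    have "w = (2 * real m - 1 - 2 * real n / 3) * d"
      using assms by (simp add: w_def u_def d_def field_simps)
    moreover have "\<bar>2 * real m - 1 - 2 * real n / 3\<bar> \<le> 1"
    proof -
      have "3 * (n div 3) \<le> n" "n \<le> 3 * (n div 3) + 2"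
        by linarith+
      then have "3 * (real m - 1) \<le> real n" "real n \<le> 3 * real m - 1"
        by (simp_all add: m_def flip: of_nat_le_iff[where 'a = real])
      then show ?thesis by (simp add: abs_le_iff)
    qed
    ultimately show ?thesis
      using d mult_right_mono[of "\<bar>2 * real m - 1 - 2 * real n / 3\<bar>" 1 d] by (simp add: abs_mult)
  qed
  have cos_w: "1 - 0.0078967 \<le> cos w" "cos w \<le> 1"
  proof -
    have "w\<^sup>2 \<le> d\<^sup>2"
      using w by (simp flip: abs_le_square_iff)
    then show "1 - 0.0078967 \<le> cos w"
      using cos_ge_quadratic[of w] dsq by simp
  qed simp
  \<comment> \<open>To first order \<open>sin w\<close> is \<open>w\<close> and
    \<open>A - B * cos w\<close> is \<open>1/2\<close>, so both terms cancel. The sign of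
    \<open>w\<close> decides whether \<open>A - B * cos w\<close> is needed from below or from
    above.\<close>
  have drift: "w / 3 - 2/3 * (sin w * (A - B * cos w)) \<le> 0.0006"
  proof (cases "0 \<le> w")
    case True
    have "w * 0.997367 \<le> w * (1 - w\<^sup>2 / 6)"
    proof (intro mult_left_mono True)
      have "w\<^sup>2 \<le> d\<^sup>2"
        using w by (simp flip: abs_le_square_iff)
      then show "0.997367 \<le> 1 - w\<^sup>2 / 6"
        using dsq by simp
    qed
    also have "\<dots> = w - w^3 / 6"
      by (simp add: algebra_simps power3_eq_cube power2_eq_square)
    also have "\<dots> \<le> sin w"
      using True by (intro sin_ge_cubic)
    finally have sin_w: "w * 0.997367 \<le> sin w" .
    have "B * cos w \<le> B * 1"
      using B1 cos_w by (intro mult_left_mono) auto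
    then have "0.494677 \<le> A - B * cos w"
      using A1 B by simp
    then have "w * 0.997367 * 0.494677 \<le> sin w * (A - B * cos w)"
      using sin_w True by (intro mult_mono) auto
    then show ?thesis
      using w d True by simp
  next
    case False
    have "1/2 * (1 - 0.0078967) \<le> B * cos w"
      using B1 cos_w by (intro mult_mono) auto
    then have "A - B * cos w \<le> 0.5066"
      using A by simp
    moreover have "0 \<le> A - B * cos w"
    proof -
      have "B * cos w \<le> B * 1"
        using B1 cos_w by (intro mult_left_mono) auto
      then show ?thesis using A1 B by simp
    qed
    moreover have "sin (- w) \<le> - w" "0 \<le> sin (- w)"
      using False w d pi_gt3 by (auto simp del: sin_minus intro!: sin_x_le_x sin_ge_zero)
    ultimately have "sin (- w) * (A - B * cos w) \<le> - w * 0.5066"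
      by (intro mult_mono) auto
    then show ?thesis
      using w d False by simp
  qed
  have sin_u: "sin u = sqrt 3 / 2 * cos w - sin w / 2"
  proof -
    have "u = 2 * pi / 3 + w" by (simp add: w_def)
    then show ?thesis by (simp add: sin_add sin_120 cos_120)
  qed
  have sin_2u: "sin (2 * u) = - (sqrt 3 / 2 * cos (2 * w)) - sin w * cos w"
  proof -
    have "cos (4 * pi / 3) = - 1/2"
      using cos_double_cos[of "2 * pi / 3"] by (simp add: cos_120 power2_eq_square)
    moreover have "sin (4 * pi / 3) = - sqrt 3 / 2"
      using sin_double[of "2 * pi / 3"] by (simp add: cos_120 sin_120)
    moreover have "2 * u = 4 * pi / 3 + 2 * w" by (simp add: w_def)
    ultimately show ?thesis by (simp add: sin_add sin_double)
  qed
  have sqrt3: "sqrt 3 \<le> 1.7320509"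
    by (rule real_le_lsqrt) (auto simp: power2_eq_square)
  have "A * sin u - B * sin (2 * u) / 2
      = sqrt 3 / 2 * (A * cos w + B / 2 * cos (2 * w)) - sin w * (A - B * cos w) / 2"
    unfolding sin_u sin_2u by (simp add: field_simps)
  also have "sqrt 3 / 2 * (A * cos w + B / 2 * cos (2 * w)) \<le> sqrt 3 / 2 * (A * 1 + B / 2 * 1)"
    using A1 B1 by (intro mult_left_mono add_mono) auto
  also have "\<dots> \<le> 1.7320509 / 2 * (1 / 0.997367 + 1 / (2 * 0.98947) / 2)"
    using A B A1 B1 sqrt3 by (intro mult_mono) auto
  finally have bound: "A * sin u - B * sin (2 * u) / 2
      \<le> 1.7320509 / 2 * (1 / 0.997367 + 1 / (2 * 0.98947) / 2) - sin w * (A - B * cos w) / 2"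
    by simp
  have "d * dual_value n (4/3) = u / 3 + 4/3 * (A * sin u - B * sin (2 * u) / 2)"
    unfolding dual_value_large_closed_form[OF assms d_def m_def]
    by (simp add: u_def A_def B_def algebra_simps)
  also have "\<dots> \<le> (2 * pi / 3 + w) / 3 + 4/3 * (1.7320509 / 2 * (1 / 0.997367 + 1 / (2 * 0.98947) / 2))
      - 2/3 * (sin w * (A - B * cos w))"
    using bound by (simp add: w_def)
  \<comment> \<open>For large \<open>n\<close> the quotient
    \<open>dual_value n (4/3) / real n\<close> tends to \<open>2/9 + 5 * sqrt 3 / (6 * pi)\<close>,
    about 0.6817. The gap to 0.683875 absorbs all errors from \<open>n = 25\<close> on.\<close>
  also have "\<dots> \<le> 0.683875 * pi"
    using drift pi_bounds by (simp add: field_simps)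
  also have "\<dots> = d * (real n * 0.683875)"
    using assms by (simp add: d_def)
  finally show ?thesis
    using d by simp
qed

section \<open>Weak duality for feasible vectors\<close>

lemma cos_residue_cong:
  fixes i j n :: nat
  assumes "i mod n = j mod n" "0 < n"
  shows "cos (2 * pi * real i / real n) = cos (2 * pi * real j / real n)"
proof -
  have *: "cos (2 * pi * real i / real n) = cos (2 * pi * real (i mod n) / real n)" for i
  proof -
    have "real i = real (i div n) * real n + real (i mod n)"
      by (metis div_mult_mod_eq of_nat_add of_nat_mult)
    then have "2 * pi * real i / real n = 2 * pi * real (i mod n) / real n + 2 * real (i div n) * pi"
      using assms(2) by (simp add: field_simps)
    then show ?thesis
      by (simp add: cos_add)
  qed
  show ?thesis
    using *[of i] *[of j] assms(1) by simp
qed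

lemma sum_blowup:
  fixes f :: "nat \<Rightarrow> 'a::comm_semiring_1"
  assumes "\<And>i. f (i mod n) = f i"
  shows "(\<Sum>l<d * n. f l) = of_nat d * (\<Sum>j<n. f j)"
proof (induction d)
  case (Suc d)
  have "{..<Suc d * n} = {..<d * n} \<union> {d * n..<d * n + n}"
    using ivl_disj_un_one(2)[of "d * n" "d * n + n"] by (simp add: add.commute)
  then have "(\<Sum>l<Suc d * n. f l) = (\<Sum>l\<in>{..<d * n} \<union> {d * n..<d * n + n}. f l)"
    by (rule arg_cong)
  also have "\<dots> = (\<Sum>l<d * n. f l) + (\<Sum>l=d * n..<d * n + n. f l)"
    by (rule sum.union_disjoint) auto
  also have "(\<Sum>l=d * n..<d * n + n. f l) = (\<Sum>j=0..<n. f (j + d * n))"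
    using sum.shift_bounds_nat_ivl[of f 0 "d * n" n] by (simp add: add.commute)
  also have "\<dots> = (\<Sum>j<n. f j)"
  proof -
    have "f (j + d * n) = f j" for j
      using assms[of "j + d * n"] assms[of j] by simp
    then show ?thesis by (simp add: atLeast0LessThan)
  qed
  finally show ?case
    by (simp add: Suc algebra_simps)
qed simp

text \<open>Multiplication by a unit permutes the residues modulo \<open>n\<close>.\<close>

lemma sum_coprime_multiples:
  fixes f :: "nat \<Rightarrow> 'a::comm_monoid_add"
  assumes "coprime q n" "0 < n"
  shows "(\<Sum>j<n. f (q * j mod n)) = (\<Sum>j<n. f j)"
proof -
  have inj: "inj_on (\<lambda>j. q * j mod n) {..<n}"
  proof (rule linorder_inj_onI')
    fix i j assume ij: "i \<in> {..<n}" "j \<in> {..<n}" "i < j"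
    show "q * i mod n \<noteq> q * j mod n"
    proof
      assume "q * i mod n = q * j mod n"
      then have "n dvd q * j - q * i"
        using ij mod_eq_dvd_iff_nat[of "q * i" "q * j" n] by simp
      then have "n dvd q * (j - i)"
        by (simp only: diff_mult_distrib2)
      then have "n dvd j - i"
        using assms(1) coprime_dvd_mult_right_iff[of n q "j - i"] by (simp add: coprime_commute)
      with ij show False
        by (auto dest: dvd_imp_le)
    qed
  qed
  moreover have "(\<lambda>j. q * j mod n) ` {..<n} = {..<n}"
    using inj assms(2) by (intro endo_inj_surj) auto
  ultimately show ?thesis
    by (metis (no_types, lifting) sum.reindex_cong)
qed

text \<open>Weak duality: subtracting \<open>r\<close> times the negative weight sum only increases
  the total, and each term is then at most \<open>max 0 (1 - r * w)\<close>. The summand 1 on the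
  left is the term \<open>l = 0\<close>, which completes the period.\<close>

lemma feasible_dual_bound:
  assumes N: "2 \<le> N" "1 \<le> p" "p \<le> N div 2" and x: "x \<in> feasible N p"
  obtains n where "5 \<le> n"
    "\<And>r. 0 \<le> r \<Longrightarrow> (\<Sum>l=1..N-1. x l) + 1 \<le> real N * (dual_value n r / real n)"
proof
  define d n q where "d = gcd N p" and "n = N div d" and "q = p div d"
  have d: "0 < d" "d dvd N" "d dvd p"
    using N by (auto simp: d_def)
  have Nd: "N = d * n" "p = d * q"
    using d by (auto simp: n_def q_def)
  have n0: "0 < n"
    using N Nd by (auto intro: Nat.gr0I)
  have "coprime n q"
    using N d unfolding n_def q_def d_def by (intro div_gcd_coprime) auto
  then have qn: "coprime q n"
    by (simp add: coprime_commute)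
  define w where "w = (\<lambda>j. weight (2 * pi * real j / real n))"
  have w_mod: "w (j mod n) = w j" for j
    using cos_residue_cong[of "j mod n" n j] n0 by (simp add: w_def weight_def)
  have angle: "2 * pi * real p * real l / real N = 2 * pi * real (q * l) / real n" for l
    using d(1) by (simp add: Nd)
  have x01: "x l = 0 \<or> x l = 1" if "l \<in> {1..N-1}" for l
    using x that by (auto simp: feasible_def PiE_def Pi_def)
  \<comment> \<open>The index \<open>k = p\<close> is admissible because
    \<open>p \<le> N div 2 < N\<close>.\<close>
  have "(\<Sum>l=1..N-1. x l * cos (2 * pi * real p * real l / real N)
            * (-1 + cos (2 * pi * real p * real l / real N))) < 0"
    using x N by (auto simp: feasible_def)
  then have neg: "(\<Sum>l=1..N-1. x l * w (q * l)) < 0"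
    unfolding angle by (simp add: w_def weight_def algebra_simps power2_eq_square)
  show "5 \<le> n"
  proof (rule ccontr)
    assume "\<not> 5 \<le> n"
    have small: "0 \<le> w j" if "j < n" for j
    proof (cases "j = 0")
      case False
      define t where "t = 2 * pi * real j / real n"
      \<comment> \<open>For \<open>n \<le> 4\<close> every nonzero grid angle lies in
        \<open>[pi / 2, 3 * pi / 2]\<close>, where the cosine is nonpositive.\<close>
      have "n \<le> 4 * j" "4 * j \<le> 3 * n"
        using that False \<open>\<not> 5 \<le> n\<close> by auto
      then have "pi / 2 \<le> t" "t \<le> 3 * pi / 2"
        using n0 by (simp_all add: t_def field_simps)
      have "cos t = - sin (t - pi / 2)"
        by (simp add: sin_diff)
      also have "\<dots> \<le> 0"
        using \<open>pi / 2 \<le> t\<close> \<open>t \<le> 3 * pi / 2\<close> sin_ge_zero[of "t - pi / 2"] by simp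
      finally show ?thesis
        by (simp add: w_def weight_def t_def[symmetric] order.trans[of _ 0])
    qed (simp add: w_def weight_def)
    have "0 \<le> w (q * l)" for l
      using small[of "q * l mod n"] n0 w_mod by simp
    then have "0 \<le> (\<Sum>l=1..N-1. x l * w (q * l))"
      using x01 by (intro sum_nonneg mult_nonneg_nonneg) fastforce+
    with neg show False by simp
  qed
  show "(\<Sum>l=1..N-1. x l) + 1 \<le> real N * (dual_value n r / real n)" if "0 \<le> r" for r
  proof -
    define h where "h = (\<lambda>j. max 0 (1 - r * w j))"
    have h_mod: "h (j mod n) = h j" for j
      by (simp add: h_def w_mod)
    have "(\<Sum>l=1..N-1. x l) \<le> (\<Sum>l=1..N-1. x l) - r * (\<Sum>l=1..N-1. x l * w (q * l))"
      using mult_nonneg_nonpos[of r "\<Sum>l=1..N-1. x l * w (q * l)"] that neg by simp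
    also have "\<dots> = (\<Sum>l=1..N-1. x l * (1 - r * w (q * l)))"
      by (simp add: sum_subtractf sum_distrib_left algebra_simps)
    also have "\<dots> \<le> (\<Sum>l=1..N-1. h (q * l))"
      using x01 by (intro sum_mono) (fastforce simp: h_def)
    also have "\<dots> + 1 = (\<Sum>l<N. h (q * l))"
    proof -
      have "{..<N} = insert 0 {1..N-1}"
        using N by auto
      then show ?thesis
        by (simp add: h_def w_def weight_def)
    qed
    also have "\<dots> = real d * (\<Sum>j<n. h (q * j))"
      unfolding Nd(1) by (rule sum_blowup) (metis h_mod mod_mult_right_eq)
    also have "(\<Sum>j<n. h (q * j)) = (\<Sum>j<n. h (q * j mod n))"
      by (simp add: h_mod)
    also have "\<dots> = dual_value n r"
      unfolding sum_coprime_multiples[OF qn n0] by (simp add: dual_value_def h_def w_def)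
    also have "real d * dual_value n r = real N * (dual_value n r / real n)"
      using n0 by (simp add: Nd)
    finally show ?thesis by simp
  qed
qed

subsection \<open>Blow-ups of a network on 19 nodes\<close>

text \<open>Multiplication by \<open>2 * sin (b / 2)\<close> telescopes the sum, and the two end
  terms agree by periodicity. This factor is nonzero because \<open>d\<close> does not divide
  \<open>a\<close>.\<close>

lemma sum_cos_progression_eq_0:
  fixes a d :: nat
  assumes "\<not> d dvd a"
  shows "(\<Sum>q<d. cos (s + real q * (2 * pi * real a / real d))) = 0"
proof (cases "d = 0")
  case False
  define b where "b = 2 * pi * real a / real d"
  have telescope: "2 * sin (b / 2) * (\<Sum>q<k. cos (s + real q * b)) = sin (s + (real k - 1/2) * b) - sin (s - b / 2)" for k
  proof (induction k)
    case (Suc k)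
    have "2 * sin (b / 2) * cos (s + real k * b) = sin ((s + real k * b) + b / 2) - sin ((s + real k * b) - b / 2)"
      by (simp add: sin_add sin_diff)
    then show ?case
      using Suc by (simp add: algebra_simps)
  qed simp
  have "s + (real d - 1/2) * b = (s - b / 2) + 2 * real a * pi"
    using False by (simp add: b_def field_simps)
  then have "sin (s + (real d - 1/2) * b) = sin (s - b / 2)"
    by (simp only: sin_add) simp
  moreover have "sin (b / 2) \<noteq> 0"
  proof
    assume "sin (b / 2) = 0"
    then obtain i :: int where "b / 2 = of_int i * pi"
      by (auto simp: sin_zero_iff_int2)
    then have "real_of_int (int a) = real_of_int (i * int d)"
      using False by (simp add: b_def field_simps)
    then have "int a = i * int d"
      by (simp only: of_int_eq_iff)
    then have "int d dvd int a" by simp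
    with assms show False by simp
  qed
  ultimately show ?thesis
    using telescope[of d] by (simp add: b_def)
qed simp

lemma sum_div_mod:
  fixes f :: "nat \<Rightarrow> 'a::comm_monoid_add"
  shows "(\<Sum>l<n * d. f l) = (\<Sum>r<n. \<Sum>q<d. f (n * q + r))"
proof (cases "n = 0")
  case False
  have "(\<Sum>l<n * d. f l) = (\<Sum>(r, q)\<in>{..<n} \<times> {..<d}. f (n * q + r))"
  proof (rule sum.reindex_bij_witness[of _ "\<lambda>(r, q). n * q + r" "\<lambda>l. (l mod n, l div n)"])
    fix rq assume "rq \<in> {..<n} \<times> {..<d}"
    then obtain r q where rq: "rq = (r, q)" "r < n" "q < d" by auto
    then have "n * q + r < n * Suc q" by simp
    also have "\<dots> \<le> n * d"
      using rq by (intro mult_le_mono) auto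
    finally show "(case rq of (r, q) \<Rightarrow> n * q + r) \<in> {..<n * d}"
      using rq by simp
  qed (use False in \<open>auto simp: less_mult_imp_div_less mult.commute\<close>)
  then show ?thesis
    by (simp add: sum.cartesian_product)
qed simp

text \<open>The Dirichlet kernel \<open>(\<Sum>r=-6..6. cos (2 * pi * j * r / 19))\<close>.\<close>

definition circulant_kernel :: "nat \<Rightarrow> real" where
  "circulant_kernel j = 2 * (\<Sum>r<7. cos (2 * pi * real (j * r) / 19)) - 1"

lemma circulant_kernel_mod: "circulant_kernel (j mod 19) = circulant_kernel j"
proof -
  have "cos (2 * pi * real (j mod 19 * r) / 19) = cos (2 * pi * real (j * r) / 19)" for r
    using cos_residue_cong[of "j mod 19 * r" 19 "j * r"] by (simp add: mod_mult_left_eq)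
  then show ?thesis
    by (simp add: circulant_kernel_def)
qed

lemma circulant_kernel_18: "circulant_kernel 18 = circulant_kernel 1"
proof -
  have "cos (2 * pi * real (18 * r) / 19) = cos (2 * pi * real r / 19)" for r
  proof -
    have "2 * pi * real (18 * r) / 19 = 2 * real r * pi - 2 * pi * real r / 19"
      by simp
    then show ?thesis
      by (simp only: cos_diff) simp
  qed
  then show ?thesis
    by (simp add: circulant_kernel_def)
qed

lemma circulant_kernel_sin: "sin (pi * real j / 19) * circulant_kernel j = sin (13 * (pi * real j / 19))"
proof -
  have "(\<Sum>r<7. cos (2 * pi * real (j * r) / 19)) = (\<Sum>r<7. cos (2 * real r * (pi * real j / 19)))"
    by (intro sum.cong refl arg_cong[where f = cos]) simp
  then show ?thesis
    using dirichlet_kernel[of 7 "pi * real j / 19"] by (simp add: circulant_kernel_def)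
qed

text \<open>The kernel is at most \<open>1 / sin (2 * pi / 19)\<close> here. By the double angle
  formula the claim becomes \<open>1 < 2 * cos (pi / 19) * sin (13 * pi / 19)\<close>, and both
  factors exceed \<open>sin (pi / 4)\<close>.\<close>

lemma circulant_kernel_less:
  assumes "2 \<le> j" "j \<le> 17"
  shows "circulant_kernel j < circulant_kernel 1"
proof -
  define s where "s = sin (2 * pi / 19)"
  have s: "0 < s" "0 < sin (pi / 19)"
    unfolding s_def by (intro sin_gt_zero; simp)+
  have s_le: "s \<le> sin (pi * real j / 19)"
  proof (cases "j \<le> 9")
    case True
    then show ?thesis
      unfolding s_def using assms by (intro sin_monotone_2pi_le) (auto simp: field_simps)
  next
    case False
    have "pi * real j / 19 = pi - pi * real (19 - j) / 19"
      using assms by (simp add: of_nat_diff field_simps)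
    then have "sin (pi * real j / 19) = sin (pi * real (19 - j) / 19)"
      by (simp only: sin_pi_minus)
    moreover have "s \<le> sin (pi * real (19 - j) / 19)"
      unfolding s_def using assms False
      by (intro sin_monotone_2pi_le) (auto simp: field_simps of_nat_diff)
    ultimately show ?thesis by simp
  qed
  have "circulant_kernel j = sin (13 * (pi * real j / 19)) / sin (pi * real j / 19)"
    using circulant_kernel_sin[of j] s s_le by (simp add: field_simps)
  also have "\<dots> \<le> 1 / sin (pi * real j / 19)"
    using s s_le by (intro divide_right_mono) auto
  also have "\<dots> \<le> 1 / s"
    using s s_le by (intro divide_left_mono mult_pos_pos) auto
  also have "\<dots> < sin (13 * pi / 19) / sin (pi / 19)"
  proof -
    have "sin (pi / 4) < cos (pi / 19)"
      using cos_monotone_0_pi[of "pi / 19" "pi / 4"] by (simp add: sin_45 cos_45)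
    moreover have "sin (pi / 4) < sin (13 * pi / 19)"
    proof -
      have "13 * pi / 19 = pi - 6 * pi / 19"
        by simp
      then have "sin (13 * pi / 19) = sin (6 * pi / 19)"
        by (simp only: sin_pi_minus)
      moreover have "sin (pi / 4) < sin (6 * pi / 19)"
        by (rule sin_monotone_2pi) auto
      ultimately show ?thesis by simp
    qed
    moreover have "0 < sin (pi / 4)"
      by (simp add: sin_45)
    ultimately have "sin (pi / 4) * sin (pi / 4) < cos (pi / 19) * sin (13 * pi / 19)"
      by (intro mult_strict_mono) auto
    then have "1 < 2 * (cos (pi / 19) * sin (13 * pi / 19))"
      by (simp add: sin_45)
    then have "sin (pi / 19) < sin (pi / 19) * (2 * (cos (pi / 19) * sin (13 * pi / 19)))"
      using s by simp
    also have "\<dots> = s * sin (13 * pi / 19)"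
      using sin_double[of "pi / 19"] by (simp add: s_def)
    finally show ?thesis
      using s by (simp add: field_simps)
  qed
  also have "\<dots> = circulant_kernel 1"
    using circulant_kernel_sin[of 1] s by (simp add: field_simps)
  finally show ?thesis .
qed

section \<open>Cosine sums over residue classes and the blown-up network\<close>

definition near_residue :: "nat \<Rightarrow> bool" where
  "near_residue l \<longleftrightarrow> l mod 19 \<le> 6 \<or> 13 \<le> l mod 19"

lemma sum_near_residue:
  fixes f :: "nat \<Rightarrow> real"
  assumes "\<And>r. 0 < r \<Longrightarrow> r < 19 \<Longrightarrow> f (19 - r) = f r"
  shows "(\<Sum>r<19. of_bool (near_residue r) * f r) = 2 * (\<Sum>r<7. f r) - f 0"
  using assms[of 1] assms[of 2] assms[of 3] assms[of 4] assms[of 5] assms[of 6]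
  by (simp add: near_residue_def lessThan_nat_numeral lessThan_Suc)

text \<open>If \<open>d\<close> divides \<open>a\<close>, the summand depends on
  \<open>l mod 19\<close> only. Otherwise, within each residue class the cosines run through a full
  progression and cancel.\<close>

lemma near_residue_sum_cos:
  fixes a d :: nat
  assumes "0 < d"
  shows "(\<Sum>l<19 * d. of_bool (near_residue l) * cos (2 * pi * real (a * l) / real (19 * d)))
    = (if d dvd a then real d * circulant_kernel (a div d) else 0)"
proof (cases "d dvd a")
  case True
  then obtain j where j: "a = d * j" by (elim dvdE)
  define g where "g = (\<lambda>l. cos (2 * pi * real (j * l) / 19))"
  have g: "of_bool (near_residue l) * cos (2 * pi * real (a * l) / real (19 * d)) = of_bool (near_residue l) * g l" for l
    using assms by (simp add: j g_def mult.assoc)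
  have g_mod: "g (l mod 19) = g l" for l
    using cos_residue_cong[of "j * (l mod 19)" 19 "j * l"] by (simp add: g_def mod_mult_right_eq)
  have "(\<Sum>l<d * 19. of_bool (near_residue l) * g l) = real d * (\<Sum>r<19. of_bool (near_residue r) * g r)"
    by (rule sum_blowup) (simp add: g_mod near_residue_def)
  also have "(\<Sum>r<19. of_bool (near_residue r) * g r) = 2 * (\<Sum>r<7. g r) - g 0"
  proof (rule sum_near_residue)
    fix r :: nat assume "0 < r" "r < 19"
    then have "2 * pi * real (j * (19 - r)) / 19 = 2 * real j * pi - 2 * pi * real (j * r) / 19"
      by (simp add: of_nat_diff field_simps)
    then show "g (19 - r) = g r"
      unfolding g_def by (simp only: cos_diff) simp
  qed
  finally show ?thesis
    unfolding g using assms by (simp add: mult.commute[of 19] j circulant_kernel_def g_def)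
next
  case False
  have "(\<Sum>q<d. of_bool (near_residue (19 * q + r)) * cos (2 * pi * real (a * (19 * q + r)) / real (19 * d))) = 0"
    if "r < 19" for r
  proof -
    have "2 * pi * real (a * (19 * q + r)) / real (19 * d)
        = 2 * pi * real (a * r) / real (19 * d) + real q * (2 * pi * real a / real d)" for q
      using assms by (simp add: field_simps)
    moreover have "near_residue (19 * q + r) = near_residue r" for q
      by (simp add: near_residue_def)
    ultimately show ?thesis
      by (simp only: sum_distrib_left[symmetric] sum_cos_progression_eq_0[OF False] mult_zero_right)
  qed
  then show ?thesis
    using False by (simp only: sum_div_mod) simp
qed

text \<open>
  Nodes are joined when their difference \<open>l\<close> is congruent to one of \<open>-5, \<dots>, 5\<close> modulo 19, and for
  \<open>M\<close> of the \<open>d\<close> differences in each of the residue classes \<open>6\<close> and \<open>-6\<close>.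
\<close>

definition chosen :: "nat \<Rightarrow> nat \<Rightarrow> nat \<Rightarrow> bool" where
  "chosen d M l \<longleftrightarrow> l mod 19 \<le> 5 \<or> 14 \<le> l mod 19 \<or> (l mod 19 = 6 \<and> l div 19 < M)
     \<or> (l mod 19 = 13 \<and> (19 * d - l) div 19 < M)"

definition witness :: "nat \<Rightarrow> nat \<Rightarrow> nat \<Rightarrow> real" where
  "witness d M = (\<lambda>l\<in>{1..19 * d - 1}. of_bool (chosen d M l))"

text \<open>Class 13 is cut by the block index of the mirror image \<open>19 * d - l\<close>, so
  reflection exchanges the two partial classes.\<close>

lemma chosen_reflect:
  assumes "0 < l" "l < 19 * d"
  shows "chosen d M (19 * d - l) \<longleftrightarrow> chosen d M l"
proof (cases "l mod 19 = 0")
  case True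
  then have "19 dvd 19 * d - l"
    by (intro dvd_diff_nat) auto
  then have "(19 * d - l) mod 19 = 0"
    by simp
  with True show ?thesis
    by (simp add: chosen_def)
next
  case False
  define q r where "q = l div 19" and "r = l mod 19"
  have l: "l = 19 * q + r" "r < 19" "0 < r"
    using False by (simp_all add: q_def r_def)
  then have "q < d"
    using assms(2) by linarith
  then have "19 * d - l = 19 * (d - q - 1) + (19 - r)"
    using l by (simp add: diff_mult_distrib2)
  then have m: "(19 * d - l) mod 19 = 19 - r"
    using l(2,3) by (simp only: mod_mult_self4) simp
  have "19 - r \<le> 5 \<longleftrightarrow> 14 \<le> r" "14 \<le> 19 - r \<longleftrightarrow> r \<le> 5" "19 - r = 6 \<longleftrightarrow> r = 13" "19 - r = 13 \<longleftrightarrow> r = 6"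
    using l by linarith+
  moreover have "19 * d - (19 * d - l) = l"
    using assms by simp
  ultimately show ?thesis
    unfolding chosen_def m r_def[symmetric] by metis
qed

lemma sum_chosen:
  fixes g :: "nat \<Rightarrow> real"
  assumes "\<And>l. g (l mod 19) = g l" "\<And>r. 0 < r \<Longrightarrow> r < 19 \<Longrightarrow> g (19 - r) = g r" "M \<le> d"
  shows "(\<Sum>l<19 * d. of_bool (chosen d M l) * g l) = real d * (2 * (\<Sum>r<6. g r) - g 0) + 2 * real M * g 6"
proof -
  have g: "g (19 * q + r) = g r" if "r < 19" for q r
    using assms(1)[of "19 * q + r"] assms(1)[of r] that by simp
  define S where "S = (\<lambda>r. \<Sum>q<d. of_bool (chosen d M (19 * q + r)) * g (19 * q + r))"
  have full: "S r = real d * g r"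
    if "r \<le> 5 \<or> 14 \<le> r" "r < 19" for r
  proof -
    have "chosen d M (19 * q + r)" for q
      using that by (auto simp: chosen_def)
    then show ?thesis
      using that by (simp add: S_def g)
  qed
  have none: "S r = 0" if "7 \<le> r" "r \<le> 12" for r
    using that by (simp add: S_def chosen_def)
  have S6: "S 6 = real M * g 6"
  proof -
    have "S 6 = (\<Sum>q<d. of_bool (q < M) * g 6)"
      by (simp add: S_def g chosen_def)
    also have "\<dots> = real (card ({..<d} \<inter> {q. q < M})) * g 6"
      by (simp flip: sum_distrib_right)
    also have "{..<d} \<inter> {q. q < M} = {..<M}"
      using assms(3) by auto
    finally show ?thesis by simp
  qed
  have S13: "S 13 = real M * g 6"
  proof -
    \<comment> \<open>Reflection reverses the order of the blocks, so in class 13 the last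
      \<open>M\<close> differences are chosen.\<close>
    have "(19 * d - (19 * q + 13)) div 19 < M \<longleftrightarrow> d - M \<le> q" if "q < d" for q
    proof -
      have "19 * d - (19 * q + 13) = 6 + 19 * (d - q - 1)"
        using that by (simp add: diff_mult_distrib2)
      then have "(19 * d - (19 * q + 13)) div 19 = d - q - 1"
        by simp
      then show ?thesis
        using that assms(3) by auto
    qed
    then have "S 13 = (\<Sum>q<d. of_bool (d - M \<le> q) * g 6)"
      using assms(2)[of 6] unfolding S_def by (intro sum.cong) (auto simp: g chosen_def)
    also have "\<dots> = real (card ({..<d} \<inter> {q. d - M \<le> q})) * g 6"
      by (simp flip: sum_distrib_right)
    also have "{..<d} \<inter> {q. d - M \<le> q} = {d - M..<d}"
      by auto
    finally show ?thesis
      using assms(3) by simp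
  qed
  have "(\<Sum>l<19 * d. of_bool (chosen d M l) * g l) = (\<Sum>r<19. S r)"
    by (simp only: sum_div_mod S_def)
  also have "\<dots> = real d * ((\<Sum>r<6. g r) + (g 14 + g 15 + g 16 + g 17 + g 18)) + 2 * real M * g 6"
    by (simp add: full none S6 S13 lessThan_nat_numeral lessThan_Suc algebra_simps)
  finally show ?thesis
    using assms(2)[of 1] assms(2)[of 2] assms(2)[of 3] assms(2)[of 4] assms(2)[of 5]
    by (simp add: lessThan_nat_numeral lessThan_Suc algebra_simps)
qed

lemma cos_residue_19_reflect:
  "r < 19 \<Longrightarrow> cos (2 * pi * real (19 - r) / 19) = cos (2 * pi * real r / 19)"
proof -
  assume "r < 19"
  then have "2 * pi * real (19 - r) / 19 = 2 * pi - 2 * pi * real r / 19"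
    by (simp add: of_nat_diff field_simps)
  then show ?thesis
    by (simp only: cos_2pi_minus)
qed

text \<open>Index 0 counts as chosen, which gives a sum over a full period. Its term vanishes in the
  constraints and causes the -1 in the connectivity.\<close>

lemma sum_to_witness:
  fixes f :: "nat \<Rightarrow> real"
  assumes "0 < d"
  shows "(\<Sum>l=1..19 * d - 1. witness d M l * f l) = (\<Sum>l<19 * d. of_bool (chosen d M l) * f l) - f 0"
proof -
  have "{..<19 * d} = insert 0 {1..19 * d - 1}"
    using assms by auto
  then show ?thesis
    by (simp add: witness_def chosen_def)
qed

text \<open>
  For \<open>k \<noteq> d, 18 * d\<close> the constraint even holds for all differences with residue \<open>-6, \<dots>, 6\<close>: there the
  sum is \<open>d / 2\<close> times \<open>K (j + 1) + K (j - 1) - 2 * K 1\<close> if \<open>k = d * j\<close>, with \<open>K\<close> the kernel above,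
  and \<open>- d * K 1\<close> if \<open>d\<close> does not divide \<open>k\<close>. Only \<open>k = d, 18 * d\<close> restrict \<open>M\<close>.
\<close>

lemma witness_constraint:
  assumes "0 < d" "M \<le> d" "k \<in> {1..19 * d - 1}"
    and neg: "real d * (2 * (\<Sum>j<6. weight (2 * pi * real j / 19))) + 2 * real M * weight (12 * pi / 19) < 0"
  shows "(\<Sum>l<19 * d. of_bool (chosen d M l) * (cos (2 * pi * real l / 19)
           * (-1 + cos (2 * pi * real k * real l / real (19 * d))))) < 0"
proof (cases "k = d \<or> k = 18 * d")
  case True
  define g where "g = (\<lambda>l. weight (2 * pi * real l / 19))"
  have eq: "cos (2 * pi * real l / 19) * (-1 + cos (2 * pi * real k * real l / real (19 * d))) = g l" for l
  proof -
    have "cos (2 * pi * real k * real l / real (19 * d)) = cos (2 * pi * real l / 19)"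
    proof (cases "k = d")
      case False
      with True have "2 * pi * real k * real l / real (19 * d) = 2 * real l * pi - 2 * pi * real l / 19"
        using assms(1) by (simp add: field_simps)
      then show ?thesis
        by (simp only: cos_diff) simp
    qed (use assms(1) in \<open>simp add: mult.assoc\<close>)
    then show ?thesis
      by (simp add: g_def weight_def power2_eq_square algebra_simps)
  qed
  have "(\<Sum>l<19 * d. of_bool (chosen d M l) * g l) = real d * (2 * (\<Sum>r<6. g r) - g 0) + 2 * real M * g 6"
  proof (rule sum_chosen)
    show "g (l mod 19) = g l" for l
      using cos_residue_cong[of "l mod 19" 19 l] by (simp add: g_def weight_def)
    show "g (19 - r) = g r" if "0 < r" "r < 19" for r
      using cos_residue_19_reflect[OF that(2)] by (simp add: g_def weight_def)
  qed fact
  moreover have "g 0 = 0"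
    by (simp add: g_def weight_def)
  ultimately have "(\<Sum>l<19 * d. of_bool (chosen d M l) * g l) < 0"
    using neg by (simp add: g_def)
  then show ?thesis
    unfolding eq .
next
  case False
  define c where "c = (\<lambda>l. cos (2 * pi * real l / 19))"
  define e where "e = (\<lambda>a. \<Sum>l<19 * d. of_bool (near_residue l) * cos (2 * pi * real (a * l) / real (19 * d)))"
  have c_neg: "c l < 0" if "l mod 19 = 6 \<or> l mod 19 = 13" for l
  proof -
    have "c l = c (l mod 19)"
      using cos_residue_cong[of "l mod 19" 19 l] by (simp add: c_def)
    also have "\<dots> = c 6"
      using that cos_residue_19_reflect[of 6] by (auto simp: c_def)
    also have "\<dots> < cos (pi / 2)"
      unfolding c_def by (rule cos_monotone_0_pi) auto
    finally show ?thesis by simp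
  qed
  \<comment> \<open>Only differences with residue 6 or 13 are added; their cosine is negative, so
    the added terms are nonnegative.\<close>
  have "(\<Sum>l<19 * d. of_bool (chosen d M l) * (c l * (-1 + cos (2 * pi * real k * real l / real (19 * d)))))
      \<le> (\<Sum>l<19 * d. of_bool (near_residue l) * (c l * (-1 + cos (2 * pi * real k * real l / real (19 * d)))))"
  proof (rule sum_mono)
    fix l
    show "of_bool (chosen d M l) * (c l * (-1 + cos (2 * pi * real k * real l / real (19 * d))))
        \<le> of_bool (near_residue l) * (c l * (-1 + cos (2 * pi * real k * real l / real (19 * d))))"
    proof (cases "chosen d M l = near_residue l")
      case False
      then have "near_residue l" "\<not> chosen d M l" and "l mod 19 = 6 \<or> l mod 19 = 13"
        by (auto simp: near_residue_def chosen_def)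
      moreover from this(3) have "0 \<le> c l * (-1 + cos (2 * pi * real k * real l / real (19 * d)))"
        using c_neg[of l] by (intro mult_nonpos_nonpos) auto
      ultimately show ?thesis by simp
    qed simp
  qed
  also have "\<dots> = (e (k + d) + e (k + 18 * d)) / 2 - e d"
  proof -
    \<comment> \<open>Product-to-sum formula. The frequency \<open>k - d\<close> appears as
      \<open>k + 18 * d\<close>, the same modulo \<open>19 * d\<close>, to avoid truncated
      subtraction.\<close>
    have "c l * (-1 + cos (2 * pi * real k * real l / real (19 * d)))
        = (cos (2 * pi * real ((k + d) * l) / real (19 * d)) + cos (2 * pi * real ((k + 18 * d) * l) / real (19 * d))) / 2
          - cos (2 * pi * real (d * l) / real (19 * d))" for l
    proof -
      define s t where "s = 2 * pi * real k * real l / real (19 * d)" and "t = 2 * pi * real l / 19"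
      have "2 * pi * real ((k + d) * l) / real (19 * d) = s + t"
        using assms(1) by (simp add: s_def t_def field_simps)
      moreover have "2 * pi * real ((k + 18 * d) * l) / real (19 * d) = (s - t) + 2 * real l * pi"
        using assms(1) by (simp add: s_def t_def field_simps)
      moreover have "2 * pi * real (d * l) / real (19 * d) = t"
        using assms(1) by (simp add: t_def)
      moreover have "cos ((s - t) + 2 * real l * pi) = cos (s - t)"
        by (simp add: cos_add)
      ultimately show ?thesis
        unfolding c_def s_def[symmetric] t_def[symmetric]
        by (simp only:) (simp add: cos_add cos_diff algebra_simps)
    qed
    then show ?thesis
      by (simp only: e_def) (simp add: sum_subtractf sum.distrib sum_divide_distrib[symmetric] algebra_simps
          flip: sum_distrib_left sum_distrib_right)
  qed
  also have "\<dots> < 0"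
  proof -
    have ed: "e d = real d * circulant_kernel 1"
      using near_residue_sum_cos[OF assms(1), of d] assms(1) by (simp add: e_def)
    show ?thesis
    proof (cases "d dvd k")
      case dvd: True
      then obtain j where j: "k = d * j" by (elim dvdE)
      have "k < 19 * d"
        using assms(1,3) by auto
      then have "d * j < d * 19"
        unfolding j by linarith
      then have "j < 19"
        by simp
      \<comment> \<open>Excluding 1 and 18 keeps \<open>j - 1\<close> and \<open>j + 1\<close> away
        from 0 modulo 19, where the kernel has its peak 13.\<close>
      have "1 \<le> j" "j \<noteq> 1" "j \<noteq> 18"
        using assms(3) False by (auto simp: j intro: Nat.gr0I)
      have e_j: "e (d * i) = real d * circulant_kernel i" for i
        using near_residue_sum_cos[OF assms(1), of "d * i"] assms(1) by (simp add: e_def)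
      have "k + d = d * (j + 1)" "k + 18 * d = d * (j + 18)"
        by (simp_all add: j algebra_simps)
      then have e_eq: "e (k + d) = real d * circulant_kernel (j + 1)" "e (k + 18 * d) = real d * circulant_kernel (j + 18)"
        by (simp_all only: e_j)
      have le: "circulant_kernel i \<le> circulant_kernel 1" if "1 \<le> i" "i \<le> 18" for i
        using that circulant_kernel_less[of i] circulant_kernel_18
        by (cases "i = 1"; cases "i = 18") auto
      have shift: "circulant_kernel (j + 18) = circulant_kernel (j - 1)"
      proof -
        have "j + 18 = (j - 1) + 19"
          using \<open>1 \<le> j\<close> by simp
        then have "(j + 18) mod 19 = (j - 1) mod 19"
          by (simp only: mod_add_self2)
        then show ?thesis
          using circulant_kernel_mod[of "j + 18"] circulant_kernel_mod[of "j - 1"] by simp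
      qed
      have "circulant_kernel (j + 1) + circulant_kernel (j - 1) < 2 * circulant_kernel 1"
      \<comment> \<open>For \<open>j = 2\<close> the kernel at \<open>j - 1\<close> equals its value
        at 1, so strictness must come from \<open>j + 1 = 3\<close>.\<close>
      proof (cases "j = 2")
        case True
        then show ?thesis
          using circulant_kernel_less[of 3] by simp
      next
        case False
        then have "circulant_kernel (j - 1) < circulant_kernel 1"
          using \<open>1 \<le> j\<close> \<open>j < 19\<close> \<open>j \<noteq> 1\<close> by (intro circulant_kernel_less) auto
        moreover have "circulant_kernel (j + 1) \<le> circulant_kernel 1"
          using \<open>1 \<le> j\<close> \<open>j < 19\<close> \<open>j \<noteq> 18\<close> by (intro le) auto
        ultimately show ?thesis by simp
      qed
      then have "real d * (circulant_kernel (j + 1) + circulant_kernel (j - 1)) < real d * (2 * circulant_kernel 1)"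
        using assms(1) by simp
      then show ?thesis
        unfolding e_eq ed shift by (simp add: algebra_simps)
    next
      case ndvd: False
      have "0 < circulant_kernel 1"
      proof -
        have "0 < sin (pi / 19)" "0 < sin (13 * pi / 19)"
          by (intro sin_gt_zero; simp)+
        then show ?thesis
          using circulant_kernel_sin[of 1] zero_less_mult_pos[of "sin (pi / 19)" "circulant_kernel 1"] by simp
      qed
      moreover have "e (k + d) = 0" "e (k + 18 * d) = 0"
        using ndvd near_residue_sum_cos[OF assms(1)] by (simp_all add: e_def dvd_add_left_iff)
      ultimately show ?thesis
        using ed assms(1) by simp
    qed
  qed
  finally show ?thesis
    by (simp add: c_def)
qed

lemma witness_feasible:
  assumes "0 < d" "M \<le> d"
    and neg: "real d * (2 * (\<Sum>j<6. weight (2 * pi * real j / 19))) + 2 * real M * weight (12 * pi / 19) < 0"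
  shows "witness d M \<in> feasible (19 * d) d"
proof -
  have "(\<Sum>l=1..19 * d - 1. witness d M l * cos (2 * pi * real d * real l / real (19 * d))
                      * (-1 + cos (2 * pi * real k * real l / real (19 * d)))) < 0"
    if k: "k \<in> {1..19 * d - 1}" for k
  proof -
    have "2 * pi * real d * real l / real (19 * d) = 2 * pi * real l / 19" for l
      using assms(1) by simp
    then show ?thesis
      using sum_to_witness[OF assms(1), of M "\<lambda>l. cos (2 * pi * real l / 19)
          * (-1 + cos (2 * pi * real k * real l / real (19 * d)))"] witness_constraint[OF assms(1,2) k neg]
      by (simp only: mult.assoc) simp
  qed
  moreover have "witness d M k = witness d M (19 * d - k)" if "k \<in> {1..19 * d - 1}" for k
  proof -
    have "0 < k" "k < 19 * d"
      using that assms(1) by auto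
    then show ?thesis
      using that chosen_reflect[of k d M] by (auto simp: witness_def)
  qed
  moreover have "witness d M \<in> {1..19 * d - 1} \<rightarrow>\<^sub>E {0, 1}"
    by (auto simp: witness_def)
  ultimately show ?thesis
    unfolding feasible_def by blast
qed

lemma witness_connectivity:
  assumes "0 < d" "M \<le> d"
  shows "connectivity (19 * d) (witness d M) = (11 * real d + 2 * real M - 1) / (19 * real d - 1)"
  using sum_chosen[of "\<lambda>_. 1" M d] sum_to_witness[OF assms(1), of M "\<lambda>_. 1"] assms
  by (simp add: connectivity_def)

subsection \<open>The supremum\<close>

text \<open>
  Twice the fraction of the residue classes \<open>6\<close> and \<open>-6\<close> modulo 19 that fits into the constraint \<open>k = p\<close>.
\<close>

definition critical_ratio :: real where
  "critical_ratio = - 2 * (\<Sum>j<6. weight (2 * pi * real j / 19)) / weight (12 * pi / 19)"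

lemma critical_ratio_bounds: "1.993625 \<le> critical_ratio" "critical_ratio \<le> 1.993643"
  using weight_19_bounds by (simp_all add: critical_ratio_def field_simps)

lemma dual_value_bound:
  assumes "5 \<le> n"
  shows "\<exists>r\<ge>0. dual_value n r \<le> real n * ((11 + critical_ratio) / 19)"
proof (cases "n = 19")
  case True
  have "dual_value n (1 / weight (12 * pi / 19)) \<le> real n * ((11 + critical_ratio) / 19)"
    using dual_value_19 by (simp add: True critical_ratio_def)
  then show ?thesis
    using weight_19_bounds(1) by (intro exI[of _ "1 / weight (12 * pi / 19)"]) auto
next
  case False
  have "\<exists>r\<ge>0. dual_value n r \<le> real n * 0.683875"
  proof (cases "n \<le> 24")
    case True
    then show ?thesis
      using dual_value_small[OF assms True False] small_order_weight_sum[OF assms True False] by blast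
  next
    case False
    then show ?thesis
      using dual_value_large[of n] by (intro exI[of _ "4/3"]) auto
  qed
  then obtain r where "0 \<le> r" "dual_value n r \<le> real n * 0.683875"
    by blast
  moreover have "real n * 0.683875 \<le> real n * ((11 + critical_ratio) / 19)"
    using critical_ratio_bounds by (intro mult_left_mono) auto
  ultimately show ?thesis
    by force
qed

lemma connectivity_upper_bound:
  assumes N: "2 \<le> N" "1 \<le> p" "p \<le> N div 2" and x: "x \<in> feasible N p"
  shows "connectivity N x \<le> (11 + critical_ratio) / 19"
proof -
  define C where "C = (11 + critical_ratio) / 19"
  obtain n where n: "5 \<le> n"
    "\<And>r. 0 \<le> r \<Longrightarrow> (\<Sum>l=1..N-1. x l) + 1 \<le> real N * (dual_value n r / real n)"
    by (rule feasible_dual_bound[OF assms]) blast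
  obtain r where r: "0 \<le> r" "dual_value n r \<le> real n * C"
    using dual_value_bound[OF n(1)] unfolding C_def by blast
  have "dual_value n r / real n \<le> C"
    using r n(1) by (simp add: field_simps)
  then have "real N * (dual_value n r / real n) \<le> real N * C"
    by (intro mult_left_mono) auto
  then have "(\<Sum>l=1..N-1. x l) \<le> real N * C - 1"
    using n(2)[OF r(1)] by linarith
  \<comment> \<open>The -1 from the index 0 pays for the passage from \<open>N\<close> to
    \<open>N - 1\<close>, because \<open>C \<le> 1\<close>.\<close>
  also have "\<dots> \<le> (real N - 1) * C"
  proof -
    have "C \<le> 1"
      using critical_ratio_bounds by (simp add: C_def)
    then show ?thesis
      by (simp add: algebra_simps)
  qed
  finally show ?thesis
    using N by (simp add: connectivity_def C_def[symmetric] pos_divide_le_eq mult.commute)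
qed

lemma mu_in_mu_values:
  assumes "0 < d" "M \<le> d" "2 * real M < critical_ratio * real d"
  shows "mu (19 * d) d \<in> mu_values"
    and "(11 * real d + 2 * real M - 1) / (19 * real d - 1) \<le> mu (19 * d) d"
proof -
  have "real d * (2 * (\<Sum>j<6. weight (2 * pi * real j / 19))) = - (critical_ratio * real d * weight (12 * pi / 19))"
    using weight_19_bounds(1) by (simp add: critical_ratio_def)
  moreover have "2 * real M * weight (12 * pi / 19) < critical_ratio * real d * weight (12 * pi / 19)"
    using assms(3) weight_19_bounds(1) by simp
  ultimately have feas: "witness d M \<in> feasible (19 * d) d"
    using assms by (intro witness_feasible) auto
  have "2 \<le> 19 * d" "1 \<le> d" "d \<le> 19 * d div 2" "feasible (19 * d) d \<noteq> {}"
    using assms(1) feas by auto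
  then show "mu (19 * d) d \<in> mu_values"
    unfolding mu_values_def by blast
  have "connectivity (19 * d) (witness d M) \<le> mu (19 * d) d"
    unfolding mu_def using feas by (intro Max_ge) (auto simp: finite_feasible)
  then show "(11 * real d + 2 * real M - 1) / (19 * real d - 1) \<le> mu (19 * d) d"
    by (simp add: witness_connectivity[OF assms(1,2)])
qed

lemma mu_bar_eq: "mu_bar = (11 + critical_ratio) / 19"
proof (rule antisym)
  show "mu_bar \<le> (11 + critical_ratio) / 19"
    unfolding mu_bar_def
  proof (rule cSup_least[OF mu_values_nonempty])
    fix y assume "y \<in> mu_values"
    then obtain N p where y: "y = mu N p" "2 \<le> N" "1 \<le> p" "p \<le> N div 2" "feasible N p \<noteq> {}"
      by (auto simp: mu_values_def)
    have "connectivity N x \<le> (11 + critical_ratio) / 19" if "x \<in> feasible N p" for x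
      using y(2-4) that by (rule connectivity_upper_bound)
    then show "y \<le> (11 + critical_ratio) / 19"
      using y(5) unfolding y(1) mu_def by (subst Max_le_iff) (auto simp: finite_feasible)
  qed
  show "(11 + critical_ratio) / 19 \<le> mu_bar"
  proof (rule field_le_epsilon)
    fix e :: real assume "0 < e"
    obtain d where "0 < d" and inv: "inverse (real d) < e"
      using ex_inverse_of_nat_less[OF \<open>0 < e\<close>] by blast
    \<comment> \<open>The largest integer with \<open>2 * real M < critical_ratio * real d\<close>;
      the strict constraint is why \<open>floor\<close> would fail when the bound is an
      integer.\<close>
    define M where "M = nat (\<lceil>critical_ratio * real d / 2\<rceil> - 1)"
    have pos: "0 < critical_ratio * real d / 2"
      using \<open>0 < d\<close> critical_ratio_bounds by simp
    then have "real M = of_int \<lceil>critical_ratio * real d / 2\<rceil> - 1"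
      by (simp add: M_def)
    then have M: "2 * real M < critical_ratio * real d" "critical_ratio * real d - 2 \<le> 2 * real M"
      using ceiling_correct[of "critical_ratio * real d / 2"] by linarith+
    have "critical_ratio * real d \<le> 2 * real d"
      using critical_ratio_bounds by (intro mult_right_mono) auto
    then have "M \<le> d"
      using M(1) by linarith
    \<comment> \<open>The numerator loses at most 2 by rounding \<open>M\<close> and 1 by the index
      0, and \<open>3 / (19 * d)\<close> is below \<open>e\<close>.\<close>
    have "(11 + critical_ratio) / 19 - e \<le> (11 + critical_ratio) / 19 - 3 / (19 * real d)"
      using inv \<open>0 < d\<close> by (simp add: field_simps)
    also have "\<dots> = ((11 + critical_ratio) * real d - 3) / (19 * real d)"
      using \<open>0 < d\<close> by (simp add: field_simps)
    also have "\<dots> \<le> (11 * real d + 2 * real M - 1) / (19 * real d)"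
      using M(2) by (intro divide_right_mono) (auto simp: algebra_simps)
    also have "\<dots> \<le> (11 * real d + 2 * real M - 1) / (19 * real d - 1)"
      using \<open>0 < d\<close> by (intro divide_left_mono) auto
    also have "\<dots> \<le> mu (19 * d) d"
      using mu_in_mu_values(2)[OF \<open>0 < d\<close> \<open>M \<le> d\<close> M(1)] .
    also have "\<dots> \<le> mu_bar"
      unfolding mu_bar_def
      using mu_in_mu_values(1)[OF \<open>0 < d\<close> \<open>M \<le> d\<close> M(1)] by (intro cSup_upper bdd_above_mu_values)
    finally show "(11 + critical_ratio) / 19 \<le> mu_bar + e"
      by linarith
  qed
qed

theorem theorem2:
  shows "mu_bar = 11 / 19 - 2 / 19 *
           ((\<Sum>l=1..5::nat. - cos (2 * pi * real l / 19) + (cos (2 * pi * real l / 19))\<^sup>2)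
            / (- cos (12 * pi / 19) + (cos (12 * pi / 19))\<^sup>2))
         \<and> 0.683875 \<le> mu_bar \<and> mu_bar < 0.683876"
proof -
  define X where "X = (\<Sum>l=1..5::nat. - cos (2 * pi * real l / 19) + (cos (2 * pi * real l / 19))\<^sup>2)
            / (- cos (12 * pi / 19) + (cos (12 * pi / 19))\<^sup>2)"
  \<comment> \<open>The index 0 has weight 0, so the sum may start at 1.\<close>
  have "{..<6::nat} = insert 0 {1..5}"
    by auto
  then have "critical_ratio = - 2 * X"
    by (simp add: X_def critical_ratio_def weight_def)
  then have "mu_bar = 11 / 19 - 2 / 19 * X"
    by (simp add: mu_bar_eq)
  moreover have "0.683875 \<le> mu_bar" "mu_bar < 0.683876"
    using critical_ratio_bounds by (simp_all add: mu_bar_eq)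
  ultimately show ?thesis
    by (simp only: X_def)
qed

end
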